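(* Let $v$ be a vertex of a connected graph $G$. Then $G$ has two level-disjoint partitions rooted in $v$ if and only if every block $B$ of $G$ containing $v$ satisfies: (a) $B$ is $2$-connected, and (b) $B$ is non-bipartite, or $B$ contains an even cycle $C$ through $v$ together with a path chordal to $C$ that separates $v$ and $\overline{v}_C$.
   Context: All graphs are simple, connected and undirected. For $S\subseteq V(G)$, $N(S)$ is the set of vertices adjacent to some vertex of $S$. A level partition of $G$ is a tuple $\mathcal{S}=(S_0,\dots,S_h)$ of pairwise disjoint sets with union $V(G)$ such that $S_i\subseteq N(S_{i-1})$ for $1\le i\le h$; $h=h(\mathcal{S})$ is its height; it is rooted in $v$ if $S_0=\{v\}$. Two level partitions $\mathcal{S},\mathcal{T}$ are level-disjoint if $S_i\cap T_i=\emptyset$ for every $1\le i\le \min(h(\mathcal{S}),h(\mathcal{T}))$. A block is a maximal connected subgraph without a cut-vertex (so a block is 2-connected, a single edge, or an isolated vertex). A path $uPw$ is chordal to a cycle $C$ if $V(P)\cap V(C)=\{u,w\}$; it separates $x,y\in V(C)$ if $x,y$ lie in different components of $C-\{u,w\}$. For an even cycle $C$ through $v$, $\overline{v}_C$ is the vertex of $C$ at distance $|C|/2$ from $v$ along $C$.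
   Formalization: The graph G is taken to be finite and to have more than one vertex; for the one-vertex graph the claim fails, since ({v}) and ({v}) are vacuously level-disjoint while the only block {v} is not 2-connected. *)

theory Defs
  imports Main
begin

definition simple_graph :: "'a set \<Rightarrow> ('a \<Rightarrow> 'a \<Rightarrow> bool) \<Rightarrow> bool" where
  "simple_graph V E \<longleftrightarrow> finite V \<and> (\<forall>x y. E x y \<longrightarrow> x \<in> V \<and> y \<in> V \<and> x \<noteq> y \<and> E y x)"

definition reach :: "'a set \<Rightarrow> ('a \<Rightarrow> 'a \<Rightarrow> bool) \<Rightarrow> 'a \<Rightarrow> 'a \<Rightarrow> bool" where
  "reach W F x y \<longleftrightarrow> x \<in> W \<and> y \<in> W \<and> (\<lambda>a b. F a b \<and> a \<in> W \<and> b \<in> W)\<^sup>*\<^sup>* x y"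

definition connected_graph :: "'a set \<Rightarrow> ('a \<Rightarrow> 'a \<Rightarrow> bool) \<Rightarrow> bool" where
  "connected_graph W F \<longleftrightarrow> W \<noteq> {} \<and> (\<forall>x\<in>W. \<forall>y\<in>W. reach W F x y)"

definition subgraph :: "'a set \<Rightarrow> ('a \<Rightarrow> 'a \<Rightarrow> bool) \<Rightarrow> 'a set \<Rightarrow> ('a \<Rightarrow> 'a \<Rightarrow> bool) \<Rightarrow> bool" where
  "subgraph W F V E \<longleftrightarrow> W \<subseteq> V \<and> (\<forall>x y. F x y \<longrightarrow> E x y \<and> x \<in> W \<and> y \<in> W \<and> F y x)"

definition cut_vertex :: "'a set \<Rightarrow> ('a \<Rightarrow> 'a \<Rightarrow> bool) \<Rightarrow> 'a \<Rightarrow> bool" where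
  "cut_vertex W F x \<longleftrightarrow> x \<in> W \<and> (\<exists>u\<in>W - {x}. \<exists>w\<in>W - {x}. \<not> reach (W - {x}) F u w)"

definition is_block :: "'a set \<Rightarrow> ('a \<Rightarrow> 'a \<Rightarrow> bool) \<Rightarrow> 'a set \<Rightarrow> ('a \<Rightarrow> 'a \<Rightarrow> bool) \<Rightarrow> bool" where
  "is_block V E W F \<longleftrightarrow>
     subgraph W F V E \<and> connected_graph W F \<and> (\<forall>x. \<not> cut_vertex W F x) \<and>
     (\<forall>W' F'. subgraph W' F' V E \<and> connected_graph W' F' \<and> (\<forall>x. \<not> cut_vertex W' F' x) \<and>
              W \<subseteq> W' \<and> (\<forall>x y. F x y \<longrightarrow> F' x y) \<longrightarrow> W' = W \<and> F' = F)"

definition two_connected :: "'a set \<Rightarrow> ('a \<Rightarrow> 'a \<Rightarrow> bool) \<Rightarrow> bool" where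
  "two_connected W F \<longleftrightarrow> finite W \<and> card W \<ge> 3 \<and> connected_graph W F \<and>
     (\<forall>x\<in>W. connected_graph (W - {x}) F)"

definition bipartite :: "'a set \<Rightarrow> ('a \<Rightarrow> 'a \<Rightarrow> bool) \<Rightarrow> bool" where
  "bipartite W F \<longleftrightarrow> (\<exists>X Y. X \<inter> Y = {} \<and> X \<union> Y = W \<and>
     (\<forall>x y. F x y \<and> x \<in> W \<and> y \<in> W \<longrightarrow> (x \<in> X \<and> y \<in> Y) \<or> (x \<in> Y \<and> y \<in> X)))"

definition is_cycle :: "'a set \<Rightarrow> ('a \<Rightarrow> 'a \<Rightarrow> bool) \<Rightarrow> 'a list \<Rightarrow> bool" where
  "is_cycle W F cs \<longleftrightarrow> length cs \<ge> 3 \<and> distinct cs \<and> set cs \<subseteq> W \<and>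
     (\<forall>i < length cs. F (cs ! i) (cs ! ((i + 1) mod length cs)))"

definition cycle_adj :: "'a list \<Rightarrow> 'a \<Rightarrow> 'a \<Rightarrow> bool" where
  "cycle_adj cs x y \<longleftrightarrow> (\<exists>i < length cs.
      (x = cs ! i \<and> y = cs ! ((i + 1) mod length cs)) \<or> (y = cs ! i \<and> x = cs ! ((i + 1) mod length cs)))"

definition is_path :: "'a set \<Rightarrow> ('a \<Rightarrow> 'a \<Rightarrow> bool) \<Rightarrow> 'a list \<Rightarrow> bool" where
  "is_path W F ps \<longleftrightarrow> ps \<noteq> [] \<and> distinct ps \<and> set ps \<subseteq> W \<and>
     (\<forall>i. i + 1 < length ps \<longrightarrow> F (ps ! i) (ps ! (i + 1)))"

definition chordal_path :: "'a list \<Rightarrow> 'a list \<Rightarrow> bool" where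
  "chordal_path ps cs \<longleftrightarrow> set ps \<inter> set cs = {hd ps, last ps}"

definition separates :: "'a list \<Rightarrow> 'a list \<Rightarrow> 'a \<Rightarrow> 'a \<Rightarrow> bool" where
  "separates ps cs x y \<longleftrightarrow>
     (let R = set cs - {hd ps, last ps} in x \<in> R \<and> y \<in> R \<and> \<not> reach R (cycle_adj cs) x y)"

(* antipodal vertex of v on an even cycle cs starting at v = cs!0 *)
definition antipode :: "'a list \<Rightarrow> 'a" where
  "antipode cs = cs ! (length cs div 2)"

definition nbhd :: "('a \<Rightarrow> 'a \<Rightarrow> bool) \<Rightarrow> 'a set \<Rightarrow> 'a set" where
  "nbhd E S = {y. \<exists>x\<in>S. E x y}"

definition level_partition :: "'a set \<Rightarrow> ('a \<Rightarrow> 'a \<Rightarrow> bool) \<Rightarrow> 'a set list \<Rightarrow> bool" where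
  "level_partition V E S \<longleftrightarrow> S \<noteq> [] \<and>
     (\<forall>i j. i < length S \<and> j < length S \<and> i \<noteq> j \<longrightarrow> S ! i \<inter> S ! j = {}) \<and>
     \<Union>(set S) = V \<and>
     (\<forall>i. 1 \<le> i \<and> i < length S \<longrightarrow> S ! i \<subseteq> nbhd E (S ! (i - 1)))"

definition height :: "'a set list \<Rightarrow> nat" where
  "height S = length S - 1"

definition rooted_in :: "'a set list \<Rightarrow> 'a \<Rightarrow> bool" where
  "rooted_in S v \<longleftrightarrow> S \<noteq> [] \<and> S ! 0 = {v}"

definition level_disjoint :: "'a set list \<Rightarrow> 'a set list \<Rightarrow> bool" where
  "level_disjoint S T \<longleftrightarrow> (\<forall>i. 1 \<le> i \<and> i \<le> min (height S) (height T) \<longrightarrow> S ! i \<inter> T ! i = {})"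

end

theory Submission
  imports Defs
begin

text \<open>A level partition rooted in \<^term>\<open>v\<close> is the same as a level function, in which every vertex
  other than \<^term>\<open>v\<close> has a neighbour one level lower, and two partitions are level-disjoint iff
  their level functions \<^term>\<open>a\<close> and \<^term>\<open>b\<close> differ everywhere off \<^term>\<open>v\<close>. Once a vertex
  \<^term>\<open>y \<noteq> v\<close> has distinct levels, neighbours of \<^term>\<open>y\<close> can be added one level above it in both
  functions, so for sufficiency it is enough to treat one odd cycle through \<^term>\<open>v\<close>, or one even
  cycle with a separating chordal path, in each block at \<^term>\<open>v\<close>.

  For necessity the level functions restrict to a bipartite block, where they have equal parity. Let
  every vertex \<^term>\<open>z \<noteq> v\<close> point to its parent for the larger of its two levels, and thereby to a
  component of the block minus \<^term>\<open>v\<close> and \<^term>\<open>z\<close>. A vertex for which this component is smallest yields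
  a set \<^term>\<open>X\<close> into which all its members point and which is not separated by them. At a vertex
  \<^term>\<open>g\<close> of \<^term>\<open>X\<close> whose branch leaves \<^term>\<open>X\<close> at the highest possible level, the branches for
  \<^term>\<open>a\<close> and \<^term>\<open>b\<close> form an even cycle whose antipode lies in \<^term>\<open>X\<close>, and a path connecting
  its two arcs within the pointed-to component is the desired chordal path.\<close>

section \<open>Reachability and level functions\<close>

lemma reach_refl: "x \<in> W \<Longrightarrow> reach W F x x"
  by (simp add: reach_def)

lemma reach_trans: "reach W F x y \<Longrightarrow> reach W F y z \<Longrightarrow> reach W F x z"
  unfolding reach_def by (meson rtranclp_trans)

lemma reach_edge: "F x y \<Longrightarrow> x \<in> W \<Longrightarrow> y \<in> W \<Longrightarrow> reach W F x y"
  by (simp add: reach_def r_into_rtranclp)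

lemma reach_mem: "reach W F x y \<Longrightarrow> x \<in> W \<and> y \<in> W"
  by (simp add: reach_def)

lemma reach_sym:
  assumes "symp F" "reach W F x y"
  shows "reach W F y x"
proof -
  have "symp (\<lambda>a b. F a b \<and> a \<in> W \<and> b \<in> W)"
    using assms(1) by (auto simp: symp_def)
  then show ?thesis
    using assms(2) sympD[OF symp_rtranclp] unfolding reach_def by fast
qed

lemma reach_mono:
  assumes "reach W F x y" "W \<subseteq> W'" "\<And>x y. F x y \<Longrightarrow> x \<in> W \<Longrightarrow> y \<in> W \<Longrightarrow> F' x y"
  shows "reach W' F' x y"
proof -
  have "(\<lambda>a b. F a b \<and> a \<in> W \<and> b \<in> W) \<le> (\<lambda>a b. F' a b \<and> a \<in> W' \<and> b \<in> W')"
    using assms by auto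
  then have "(\<lambda>a b. F' a b \<and> a \<in> W' \<and> b \<in> W')\<^sup>*\<^sup>* x y"
    using assms(1) rtranclp_mono by (auto simp: reach_def)
  then show ?thesis
    using assms by (auto simp: reach_def)
qed

lemma reach_induct [consumes 1, case_names base step]:
  assumes "reach W F x y" "P x"
    "\<And>y z. reach W F x y \<Longrightarrow> P y \<Longrightarrow> F y z \<Longrightarrow> z \<in> W \<Longrightarrow> P z"
  shows "P y"
proof -
  have "(\<lambda>a b. F a b \<and> a \<in> W \<and> b \<in> W)\<^sup>*\<^sup>* x y" "x \<in> W"
    using assms(1) by (auto simp: reach_def)
  then have "P y \<and> reach W F x y"
  proof (induction rule: rtranclp_induct)
    case base
    then show ?case using assms(2) by (simp add: reach_refl)
  next
    case (step y z)
    then show ?case using assms(3)[of y z] reach_edge[of F y z W] reach_trans by metis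
  qed
  then show ?thesis by blast
qed

lemma reach_converse_induct [consumes 1, case_names base step]:
  assumes "reach W F x y" "P y"
    "\<And>x z. F x z \<Longrightarrow> x \<in> W \<Longrightarrow> reach W F z y \<Longrightarrow> P z \<Longrightarrow> P x"
  shows "P x"
proof -
  have "(\<lambda>a b. F a b \<and> a \<in> W \<and> b \<in> W)\<^sup>*\<^sup>* x y" "y \<in> W"
    using assms(1) by (auto simp: reach_def)
  then have "P x \<and> reach W F x y"
  proof (induction rule: converse_rtranclp_induct)
    case base
    then show ?case using assms(2) by (simp add: reach_refl)
  next
    case (step x z)
    then show ?case using assms(3)[of x z] reach_edge[of F x z W] reach_trans by metis
  qed
  then show ?thesis by blast
qed

text \<open>The path is built backwards: a new first vertex in \<open>Q\<close> replaces the whole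
  path, and one already on the path cuts off what precedes it. Meeting \<open>Q\<close> only at the
  last vertex is what ears and chordal paths require.\<close>

lemma reach_first_hit:
  assumes "reach W F x y" "y \<in> Q"
  obtains xs where "xs \<noteq> []" "hd xs = x" "last xs \<in> Q" "set (butlast xs) \<inter> Q = {}"
    "distinct xs" "set xs \<subseteq> W" "successively F xs"
proof -
  have "\<exists>xs. xs \<noteq> [] \<and> hd xs = x \<and> last xs \<in> Q \<and> set (butlast xs) \<inter> Q = {} \<and>
    distinct xs \<and> set xs \<subseteq> W \<and> successively F xs"
    using assms(1)
  proof (induction rule: reach_converse_induct)
    case base
    then show ?case using assms reach_mem[OF assms(1)] by (intro exI[of _ "[y]"]) auto
  next
    case (step x z)
    then obtain xs where xs: "xs \<noteq> []" "hd xs = z" "last xs \<in> Q" "set (butlast xs) \<inter> Q = {}"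
      "distinct xs" "set xs \<subseteq> W" "successively F xs" by blast
    consider "x \<in> Q" | "x \<notin> Q" "x \<notin> set xs" | "x \<in> set xs" by blast
    then show ?case
    proof cases
      case 1
      then show ?thesis using step by (intro exI[of _ "[x]"]) auto
    next
      case 2
      then show ?thesis using xs step
        by (intro exI[of _ "x # xs"]) (auto simp: successively_Cons)
    next
      case 3
      then obtain ys zs where "xs = ys @ x # zs" by (meson split_list)
      then show ?thesis using xs
        by (intro exI[of _ "x # zs"]) (auto simp: successively_append_iff butlast_append)
    qed
  qed
  then show ?thesis using that by blast
qed

lemma reach_path:
  assumes "reach W F x y"
  obtains xs where "xs \<noteq> []" "hd xs = x" "last xs = y" "distinct xs" "set xs \<subseteq> W" "successively F xs"
  using reach_first_hit[OF assms, of "{y}"] by blast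

lemma successively_reach:
  assumes "successively F xs" "set xs \<subseteq> W" "xs \<noteq> []"
  shows "reach W F (hd xs) (last xs)"
  using assms
proof (induction xs rule: induct_list012)
  case (3 x y zs)
  then have "reach W F x y" by (intro reach_edge) auto
  moreover have "reach W F y (last (y # zs))" using 3 by simp
  ultimately show ?case using reach_trans[of W F x y] by simp
qed (auto intro: reach_refl)

lemma is_path_iff_successively:
  "is_path W F ps \<longleftrightarrow> ps \<noteq> [] \<and> distinct ps \<and> set ps \<subseteq> W \<and> successively F ps"
  by (simp add: is_path_def successively_conv_nth)

lemma connected_reach: "connected_graph W F \<Longrightarrow> x \<in> W \<Longrightarrow> y \<in> W \<Longrightarrow> reach W F x y"
  by (simp add: connected_graph_def)

section \<open>Level functions and their translation into rooted partitions\<close>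

text \<open>\<open>a x\<close> is the index of the level containing \<open>x\<close>. It need not be
  the distance from \<open>v\<close>: some neighbour is exactly one level lower, but others may be
  much lower.\<close>

definition levels :: "'a set \<Rightarrow> ('a \<Rightarrow> 'a \<Rightarrow> bool) \<Rightarrow> 'a \<Rightarrow> ('a \<Rightarrow> nat) \<Rightarrow> bool" where
  "levels W F v a \<longleftrightarrow> v \<in> W \<and> a v = 0 \<and> (\<forall>x\<in>W - {v}. \<exists>y\<in>W. F y x \<and> a x = Suc (a y))"

lemma levels_pos: "levels W F v a \<Longrightarrow> x \<in> W \<Longrightarrow> x \<noteq> v \<Longrightarrow> a x > 0"
  unfolding levels_def by (metis Diff_iff singletonD zero_less_Suc)

lemma levels_eq_0: "levels W F v a \<Longrightarrow> x \<in> W \<Longrightarrow> a x = 0 \<longleftrightarrow> x = v"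
  using levels_pos[of W F v a x] by (metis levels_def less_irrefl)

lemma levels_of_partition:
  assumes "level_partition V E S" "rooted_in S v"
  obtains a where "levels V E v a" "\<And>x. x \<in> V \<Longrightarrow> a x < length S \<and> x \<in> S ! a x"
proof -
  have U: "\<Union>(set S) = V" and S0: "S \<noteq> []" "S ! 0 = {v}"
    and dis: "\<And>i j x. i < length S \<Longrightarrow> j < length S \<Longrightarrow> x \<in> S ! i \<Longrightarrow> x \<in> S ! j \<Longrightarrow> i = j"
    and nb: "\<And>i. 1 \<le> i \<Longrightarrow> i < length S \<Longrightarrow> S ! i \<subseteq> nbhd E (S ! (i - 1))"
    using assms unfolding level_partition_def rooted_in_def by blast+
  have "\<forall>x\<in>V. \<exists>i. i < length S \<and> x \<in> S ! i"
    using U by (metis UnionE in_set_conv_nth)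
  then obtain a where a: "\<And>x. x \<in> V \<Longrightarrow> a x < length S \<and> x \<in> S ! a x"
    by metis
  have sub: "S ! i \<subseteq> V" if "i < length S" for i
    using U that by auto
  have len: "0 < length S" using S0 by simp
  have vV: "v \<in> V" using sub[OF len] S0 by simp
  have av: "a v = 0"
    using dis[of "a v" 0 v] a[OF vV] S0 len by simp
  have "\<exists>y\<in>V. E y x \<and> a x = Suc (a y)" if "x \<in> V - {v}" for x
  proof -
    have x: "a x < length S" "x \<in> S ! a x" using a that by auto
    then have "1 \<le> a x" using that S0 by (cases "a x") auto
    then obtain y where y: "y \<in> S ! (a x - 1)" "E y x"
      using nb[of "a x"] x by (auto simp: nbhd_def)
    have l: "a x - 1 < length S" using x by simp
    then have "y \<in> V" using y sub by blast
    moreover have "a y = a x - 1"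
      using dis[OF _ l, of "a y" y] a[OF \<open>y \<in> V\<close>] y by simp
    ultimately show ?thesis using y \<open>1 \<le> a x\<close> by auto
  qed
  then have "levels V E v a" using vV av unfolding levels_def by blast
  then show ?thesis using that a by blast
qed

lemma partition_of_levels:
  fixes a :: "'a \<Rightarrow> nat"
  assumes "finite V" "levels V E v a"
  defines "S \<equiv> map (\<lambda>i. {x \<in> V. a x = i}) [0..<Suc (Max (a ` V))]"
  shows "level_partition V E S" "rooted_in S v" "\<And>i x. i < length S \<Longrightarrow> x \<in> S ! i \<Longrightarrow> x \<in> V \<and> a x = i"
proof -
  have len: "length S = Suc (Max (a ` V))" by (simp add: S_def)
  have nth: "S ! i = {x \<in> V. a x = i}" if "i < length S" for i
    using that unfolding S_def by (simp del: upt_Suc)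
  show "\<And>i x. i < length S \<Longrightarrow> x \<in> S ! i \<Longrightarrow> x \<in> V \<and> a x = i"
    using nth by simp
  have "a x < length S" if "x \<in> V" for x
    using that assms(1) by (simp add: len less_Suc_eq_le)
  then have "V \<subseteq> \<Union>(set S)"
    using nth nth_mem by fastforce
  moreover have "\<Union>(set S) \<subseteq> V"
    using nth by (auto simp: in_set_conv_nth)
  moreover have "S ! i \<subseteq> nbhd E (S ! (i - 1))" if i: "1 \<le> i" "i < length S" for i
  proof
    fix x assume "x \<in> S ! i"
    then have x: "x \<in> V" "a x = i" using nth i by auto
    moreover have "x \<noteq> v" using x i assms(2) by (auto simp: levels_def)
    ultimately obtain y where y: "y \<in> V" "E y x" "a x = Suc (a y)"
      using assms(2) by (auto simp: levels_def)
    then show "x \<in> nbhd E (S ! (i - 1))"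
      using x i nth[of "i - 1"] by (auto simp: nbhd_def)
  qed
  ultimately show "level_partition V E S"
    using nth len unfolding level_partition_def by (intro conjI allI impI) (force, force, force, blast)
  show "rooted_in S v"
    using nth[of 0] levels_eq_0[OF assms(2)] assms(2) len
    unfolding rooted_in_def by (auto simp: levels_def)
qed

text \<open>If \<open>a x = b x\<close>, this number is an index of both partitions, so comparing
  levels only up to the smaller height catches every coincidence. Index 0 belongs to
  \<open>v\<close> alone.\<close>

lemma level_disjoint_partitions_iff:
  assumes "finite V"
  shows "(\<exists>S T. level_partition V E S \<and> rooted_in S v \<and> level_partition V E T \<and> rooted_in T v \<and>
             level_disjoint S T) \<longleftrightarrow>
         (\<exists>a b. levels V E v a \<and> levels V E v b \<and> (\<forall>x\<in>V - {v}. a x \<noteq> b x))"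
proof
  assume "\<exists>S T. level_partition V E S \<and> rooted_in S v \<and> level_partition V E T \<and> rooted_in T v \<and>
             level_disjoint S T"
  then obtain S T where ST: "level_partition V E S" "rooted_in S v" "level_partition V E T"
    "rooted_in T v" "level_disjoint S T" by blast
  obtain a where a: "levels V E v a" "\<And>x. x \<in> V \<Longrightarrow> a x < length S \<and> x \<in> S ! a x"
    using levels_of_partition ST(1,2) by metis
  obtain b where b: "levels V E v b" "\<And>x. x \<in> V \<Longrightarrow> b x < length T \<and> x \<in> T ! b x"
    using levels_of_partition ST(3,4) by metis
  have "a x \<noteq> b x" if "x \<in> V - {v}" for x
  proof
    assume eq: "a x = b x"
    have "1 \<le> a x" using levels_pos[OF a(1)] that by (simp add: Suc_leI)
    moreover have "a x < length S" "a x < length T" "x \<in> S ! a x \<inter> T ! a x"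
      using a(2)[of x] b(2)[of x] that eq by auto
    ultimately show False
      using ST(5) unfolding level_disjoint_def height_def by fastforce
  qed
  then show "\<exists>a b. levels V E v a \<and> levels V E v b \<and> (\<forall>x\<in>V - {v}. a x \<noteq> b x)"
    using a b by blast
next
  assume "\<exists>a b. levels V E v a \<and> levels V E v b \<and> (\<forall>x\<in>V - {v}. a x \<noteq> b x)"
  then obtain a b where a: "levels V E v a" and b: "levels V E v b"
    and ab: "\<And>x. x \<in> V - {v} \<Longrightarrow> a x \<noteq> b x" by blast
  obtain S where S: "level_partition V E S" "rooted_in S v"
    "\<And>i x. i < length S \<Longrightarrow> x \<in> S ! i \<Longrightarrow> x \<in> V \<and> a x = i"
    using partition_of_levels[OF assms a] by blast
  obtain T where T: "level_partition V E T" "rooted_in T v"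
    "\<And>i x. i < length T \<Longrightarrow> x \<in> T ! i \<Longrightarrow> x \<in> V \<and> b x = i"
    using partition_of_levels[OF assms b] by blast
  have "level_disjoint S T"
    unfolding level_disjoint_def
  proof (intro allI impI equals0I)
    fix i x assume i: "1 \<le> i \<and> i \<le> min (height S) (height T)" and x: "x \<in> S ! i \<inter> T ! i"
    then have "i < length S" "i < length T" by (auto simp: height_def)
    then have "x \<in> V" "a x = i" "b x = i" using S(3) T(3) x by auto
    then show False using ab[of x] levels_eq_0[OF a, of x] i by auto
  qed
  then show "\<exists>S T. level_partition V E S \<and> rooted_in S v \<and> level_partition V E T \<and> rooted_in T v \<and>
             level_disjoint S T"
    using S T by blast
qed

section \<open>Disjoint levels on odd cycles and on theta graphs\<close>

text \<open>The carrier \<open>W\<close> may be a small part of the graph, but the lower neighbours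
  must lie in it; this allows level functions to be grown from a seed set.\<close>

definition disjoint_levels ::
  "'a set \<Rightarrow> ('a \<Rightarrow> 'a \<Rightarrow> bool) \<Rightarrow> 'a \<Rightarrow> ('a \<Rightarrow> nat) \<Rightarrow> ('a \<Rightarrow> nat) \<Rightarrow> bool" where
  "disjoint_levels W F v a b \<longleftrightarrow> levels W F v a \<and> levels W F v b \<and> (\<forall>x\<in>W - {v}. a x \<noteq> b x)"

lemma disjoint_levels_mono:
  assumes "disjoint_levels W F v a b" "\<And>x y. F x y \<Longrightarrow> E x y"
  shows "disjoint_levels W E v a b"
  using assms unfolding disjoint_levels_def levels_def by blast

lemma obtain_fun_on_pieces:
  assumes "inj_on f I" "inj_on g J" "f ` I \<inter> g ` J = {}"
  obtains a where "\<And>i. i \<in> I \<Longrightarrow> a (f i) = \<alpha> i" "\<And>j. j \<in> J \<Longrightarrow> a (g j) = \<beta> j"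
proof
  let ?a = "\<lambda>x. if x \<in> f ` I then \<alpha> (inv_into I f x) else \<beta> (inv_into J g x)"
  show "?a (f i) = \<alpha> i" if "i \<in> I" for i using that assms by simp
  show "?a (g j) = \<beta> j" if "j \<in> J" for j using that assms by auto
qed

text \<open>The cycle is traversed in both directions, giving \<open>c i\<close> the levels
  \<open>i\<close> and \<open>n - i\<close>. They agree only if \<open>n = 2 * i\<close>, which
  oddness excludes.\<close>

lemma odd_cycle_levels:
  assumes inj: "inj_on c {..<n}" and cyc: "c n = c 0" and "odd n"
    and edge: "\<And>i. i < n \<Longrightarrow> F (c i) (c (Suc i)) \<and> F (c (Suc i)) (c i)"
  obtains a b where "disjoint_levels (c ` {..<n}) F (c 0) a b"
proof -
  have n: "0 < n" using \<open>odd n\<close> by (simp add: odd_pos)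
  obtain a where a: "\<And>i. i \<in> {..<n} \<Longrightarrow> a (c i) = i"
    using obtain_fun_on_pieces[OF inj, of c "{}" "\<lambda>i. i"] by auto
  obtain b where b: "\<And>i. i \<in> {..<n} \<Longrightarrow> b (c i) = (if i = 0 then 0 else n - i)"
    using obtain_fun_on_pieces[OF inj, of c "{}" "\<lambda>i. if i = 0 then 0 else n - i"] by auto
  have "levels (c ` {..<n}) F (c 0) a"
    unfolding levels_def
  proof (intro conjI ballI)
    fix x assume "x \<in> c ` {..<n} - {c 0}"
    then obtain i where i: "i < n" "x = c i" "i \<noteq> 0" by force
    then show "\<exists>y\<in>c ` {..<n}. F y x \<and> a x = Suc (a y)"
      using a edge[of "i - 1"] by (intro bexI[of _ "c (i - 1)"]) auto
  qed (use n a in auto)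
  moreover have "levels (c ` {..<n}) F (c 0) b"
    unfolding levels_def
  proof (intro conjI ballI)
    fix x assume "x \<in> c ` {..<n} - {c 0}"
    then obtain i where i: "i < n" "x = c i" "i \<noteq> 0" by force
    show "\<exists>y\<in>c ` {..<n}. F y x \<and> b x = Suc (b y)"
    proof (cases "Suc i = n")
      case True
      then show ?thesis using b i edge[of i] cyc n by (intro bexI[of _ "c 0"]) auto
    next
      case False
      then show ?thesis using b i edge[of i] by (intro bexI[of _ "c (Suc i)"]) auto
    qed
  qed (use n b in auto)
  moreover have "a x \<noteq> b x" if x: "x \<in> c ` {..<n} - {c 0}" for x
  proof -
    obtain i where i: "i < n" "x = c i" "i \<noteq> 0" using x by force
    then have "a x = i" "b x = n - i" using a b by auto
    moreover have "i \<noteq> n - i" using \<open>odd n\<close> i(1) by presburger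
    ultimately show ?thesis by simp
  qed
  ultimately show ?thesis using that unfolding disjoint_levels_def by blast
qed

text \<open>The cycle is \<^term>\<open>c\<close>, of length \<^term>\<open>2 * k\<close>, and its antipode \<^term>\<open>c k\<close> is the only vertex
  at which the two directions of traversal agree. The first level function therefore reaches the
  far end of the chordal path \<^term>\<open>P\<close> along the path and runs back to the antipode from there.\<close>

lemma theta_levels_aux:
  fixes c P :: "nat \<Rightarrow> 'a"
  assumes inj: "inj_on c {..<2*k}" and cyc: "c (2*k) = c 0"
    and edge: "\<And>i. i < 2*k \<Longrightarrow> F (c i) (c (Suc i)) \<and> F (c (Suc i)) (c i)"
    and pq: "0 < p" "p < k" "k < q" "q < 2*k"
    and P: "P 0 = c p" "P m = c q"
    and edgeP: "\<And>j. j < m \<Longrightarrow> F (P j) (P (Suc j))"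
    and injP: "inj_on P {0<..<m}" and disj: "c ` {..<2*k} \<inter> P ` {0<..<m} = {}"
    and less: "2*k - q < p + m"
  shows "\<exists>a b. disjoint_levels (c ` {..<2*k} \<union> P ` {0<..<m}) F (c 0) a b"
proof -
  let ?D = "c ` {..<2*k} \<union> P ` {0<..<m}"
  have m: "0 < m"
    using P pq inj by (metis gr_zeroI inj_on_eq_iff lessThan_iff less_trans not_less_iff_gr_or_eq)
  \<comment> \<open>\<open>\<alpha>\<close> follows the cycle from \<open>c 0\<close> to
    \<open>c (k - 1)\<close> and takes \<open>P\<close> from \<open>c p\<close> to
    \<open>c q\<close>, which gets level \<open>p + m\<close>; from \<open>c q\<close> it runs back
    to \<open>c k\<close> and on to \<open>c (2*k - 1)\<close>. \<open>\<beta>\<close> traverses the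
    cycle the other way and enters \<open>P\<close> at \<open>c p\<close>, whose level is then
    \<open>2*k - p\<close>.\<close>
  define \<alpha> where "\<alpha> i = (if i < k then i else if i \<le> q then p + m + q - i else p + m + i - q)" for i
  define \<beta> where "\<beta> i = (if i = 0 then 0 else 2*k - i)" for i
  obtain a where a: "\<And>i. i \<in> {..<2*k} \<Longrightarrow> a (c i) = \<alpha> i" "\<And>j. j \<in> {0<..<m} \<Longrightarrow> a (P j) = p + j"
    using obtain_fun_on_pieces[OF inj injP disj] by metis
  obtain b where b: "\<And>i. i \<in> {..<2*k} \<Longrightarrow> b (c i) = \<beta> i" "\<And>j. j \<in> {0<..<m} \<Longrightarrow> b (P j) = 2*k - p + j"
    using obtain_fun_on_pieces[OF inj injP disj] by metis
  have mem: "c i \<in> ?D" if "i < 2*k" for i using that by blast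
  have memP: "P j \<in> ?D" if "j < m" for j using that P pq by (cases "j = 0") auto
  have cases: thesis if "x \<in> ?D - {c 0}"
    "\<And>i. x = c i \<Longrightarrow> 0 < i \<Longrightarrow> i < 2*k \<Longrightarrow> thesis" "\<And>j. x = P j \<Longrightarrow> 0 < j \<Longrightarrow> j < m \<Longrightarrow> thesis" for x thesis
  proof -
    have "x \<in> c ` {..<2*k} \<or> x \<in> P ` {0<..<m}" "x \<noteq> c 0" using that(1) by auto
    then show thesis using that(2,3) by (auto simp: image_iff)
  qed
  have aP: "a (P j) = p + j" if "j < m" for j
    using a that P pq by (cases "j = 0") (auto simp: \<alpha>_def)
  have bP: "b (P j) = 2*k - p + j" if "j < m" for j
    using b that P pq by (cases "j = 0") (auto simp: \<beta>_def)
  have "\<exists>y\<in>?D. F y x \<and> a x = Suc (a y)" if x: "x \<in> ?D - {c 0}" for x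
    using x
  proof (rule cases)
    fix i assume i: "x = c i" "0 < i" "i < 2*k"
    consider "i < k \<or> q < i" | "k \<le> i" "i < q" | "i = q" using pq by linarith
    then show ?thesis
    proof cases
      case 1
      have "a x = Suc (a (c (i - 1)))"
        using i 1 pq a by (auto simp: \<alpha>_def)
      then show ?thesis using edge[of "i - 1"] i mem[of "i - 1"] by (intro bexI[of _ "c (i - 1)"]) auto
    next
      case 2
      have "a x = Suc (a (c (Suc i)))"
        using i 2 pq a by (auto simp: \<alpha>_def)
      then show ?thesis using edge[of i] i 2 pq mem[of "Suc i"] by (intro bexI[of _ "c (Suc i)"]) auto
    next
      case 3
      have "a x = Suc (a (P (m - 1)))"
        using i 3 pq a aP[of "m - 1"] m by (auto simp: \<alpha>_def)
      then show ?thesis using edgeP[of "m - 1"] i 3 m P memP[of "m - 1"]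
        by (intro bexI[of _ "P (m - 1)"]) auto
    qed
  next
    fix j assume j: "x = P j" "0 < j" "j < m"
    then show ?thesis
      using aP[of j] aP[of "j - 1"] edgeP[of "j - 1"] memP[of "j - 1"]
      by (intro bexI[of _ "P (j - 1)"]) auto
  qed
  then have "levels ?D F (c 0) a"
    using a pq unfolding levels_def by (auto simp: \<alpha>_def)
  moreover have "\<exists>y\<in>?D. F y x \<and> b x = Suc (b y)" if x: "x \<in> ?D - {c 0}" for x
    using x
  proof (rule cases)
    fix i assume i: "x = c i" "0 < i" "i < 2*k"
    show ?thesis
    proof (cases "Suc i = 2*k")
      case True
      then have "b x = Suc (b (c 0))" using b i by (auto simp: \<beta>_def)
      then show ?thesis using edge[of i] cyc True mem[of 0] i by (intro bexI[of _ "c 0"]) auto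
    next
      case False
      then have "b x = Suc (b (c (Suc i)))" using b i by (auto simp: \<beta>_def)
      then show ?thesis using edge[of i] False mem[of "Suc i"] i by (intro bexI[of _ "c (Suc i)"]) auto
    qed
  next
    fix j assume j: "x = P j" "0 < j" "j < m"
    then show ?thesis
      using bP[of j] bP[of "j - 1"] edgeP[of "j - 1"] memP[of "j - 1"]
      by (intro bexI[of _ "P (j - 1)"]) auto
  qed
  then have "levels ?D F (c 0) b"
    using b pq unfolding levels_def by (auto simp: \<beta>_def)
  \<comment> \<open>On the cycle, \<open>i < 2*k - i\<close> holds below \<open>k\<close>, and from
    \<open>k\<close> on \<open>less\<close> makes the first level the larger one. On
    \<open>P\<close> the two levels differ by \<open>2*k - 2*p\<close>.\<close>
  moreover have "a x \<noteq> b x" if x: "x \<in> ?D - {c 0}" for x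
    using x
  proof (rule cases)
    fix i assume i: "x = c i" "0 < i" "i < 2*k"
    then have "a x = \<alpha> i" "b x = 2*k - i" using a b by (auto simp: \<beta>_def)
    then show ?thesis using i pq less by (auto simp: \<alpha>_def)
  next
    fix j assume j: "x = P j" "0 < j" "j < m"
    then show ?thesis using aP bP pq by auto
  qed
  ultimately show ?thesis unfolding disjoint_levels_def by blast
qed

text \<open>If \<open>2*k - q < p + m\<close> fails, the cycle and the path are both reversed. The
  path then runs from \<open>2*k - q\<close> to \<open>2*k - p\<close>, and the inequality becomes
  \<open>p < 2*k - q + m\<close>, which follows from the failure.\<close>

lemma theta_levels:
  fixes c P :: "nat \<Rightarrow> 'a"
  assumes inj: "inj_on c {..<2*k}" and cyc: "c (2*k) = c 0"
    and edge: "\<And>i. i < 2*k \<Longrightarrow> F (c i) (c (Suc i)) \<and> F (c (Suc i)) (c i)"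
    and pq: "0 < p" "p < k" "k < q" "q < 2*k"
    and P: "P 0 = c p" "P m = c q"
    and edgeP: "\<And>j. j < m \<Longrightarrow> F (P j) (P (Suc j)) \<and> F (P (Suc j)) (P j)"
    and injP: "inj_on P {0<..<m}" and disj: "c ` {..<2*k} \<inter> P ` {0<..<m} = {}"
  shows "\<exists>a b. disjoint_levels (c ` {..<2*k} \<union> P ` {0<..<m}) F (c 0) a b"
proof (cases "2*k - q < p + m")
  case True
  then show ?thesis using theta_levels_aux[OF inj cyc edge pq P _ injP disj] edgeP by blast
next
  case False
  define c' where "c' i = c (2*k - i)" for i
  define P' where "P' j = P (m - j)" for j
  have m: "0 < m"
    using P pq inj by (metis gr_zeroI inj_on_eq_iff lessThan_iff less_trans not_less_iff_gr_or_eq)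
  have c'0: "c' 0 = c 0" using cyc by (simp add: c'_def)
  \<comment> \<open>\<open>c'\<close> starts at index \<open>2*k\<close>, a second name for
    \<open>c 0\<close>, so injectivity is needed on the indices from 1 to
    \<open>2*k\<close>.\<close>
  have inj_le: "i = j" if "c i = c j" "0 < i" "i \<le> 2*k" "0 < j" "j \<le> 2*k" for i j
  proof -
    have "c (i mod (2*k)) = c (j mod (2*k))"
      using that cyc by (cases "i = 2*k"; cases "j = 2*k") auto
    then have "i mod (2*k) = j mod (2*k)"
      using inj that by (auto simp: inj_on_def)
    then show ?thesis
      using that by (cases "i = 2*k"; cases "j = 2*k") auto
  qed
  have inj': "inj_on c' {..<2*k}"
    unfolding inj_on_def c'_def using inj_le by fastforce
  have img: "c' ` {..<2*k} = c ` {..<2*k}"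
  proof (intro equalityI subsetI)
    fix x assume "x \<in> c' ` {..<2*k}"
    then obtain i where i: "i < 2*k" "x = c (2*k - i)" by (auto simp: c'_def)
    then show "x \<in> c ` {..<2*k}" using cyc by (cases "i = 0") auto
  next
    fix x assume "x \<in> c ` {..<2*k}"
    then obtain i where i: "i < 2*k" "x = c i" by auto
    show "x \<in> c' ` {..<2*k}"
    proof (cases "i = 0")
      case True
      then show ?thesis using i c'0 by (intro image_eqI[of _ _ 0]) auto
    next
      case False
      then show ?thesis using i by (intro image_eqI[of _ _ "2*k - i"]) (auto simp: c'_def)
    qed
  qed
  have imgP: "P' ` {0<..<m} = P ` {0<..<m}"
  proof (intro equalityI subsetI)
    fix x assume "x \<in> P ` {0<..<m}"
    then obtain i where "0 < i" "i < m" "x = P i" by auto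
    then show "x \<in> P' ` {0<..<m}" by (intro image_eqI[of _ _ "m - i"]) (auto simp: P'_def)
  qed (auto simp: P'_def)
  have injP': "inj_on P' {0<..<m}"
  proof (rule inj_onI)
    fix i j assume ij: "i \<in> {0<..<m}" "j \<in> {0<..<m}" "P' i = P' j"
    then have "m - i = m - j"
      using inj_onD[OF injP, of "m - i" "m - j"] by (simp add: P'_def)
    then show "i = j" using ij(1,2) unfolding greaterThanLessThan_iff by arith
  qed
  have edge': "F (c' i) (c' (Suc i)) \<and> F (c' (Suc i)) (c' i)" if "i < 2*k" for i
    using edge[of "2*k - Suc i"] that by (simp add: c'_def Suc_diff_Suc)
  have edgeP': "F (P' j) (P' (Suc j))" if "j < m" for j
    using edgeP[of "m - Suc j"] that by (simp add: P'_def Suc_diff_Suc)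
  have "\<exists>a b. disjoint_levels (c' ` {..<2*k} \<union> P' ` {0<..<m}) F (c' 0) a b"
  proof (rule theta_levels_aux[OF inj' _ edge' _ _ _ _ _ _ edgeP' injP'])
    show "0 < 2*k - q" "2*k - q < k" "k < 2*k - p" "2*k - p < 2*k"
      "2*k - (2*k - p) < 2*k - q + m" "c' (2*k) = c' 0" "P' 0 = c' (2*k - q)" "P' m = c' (2*k - p)"
      using pq False m P cyc by (auto simp: c'_def P'_def)
    show "c' ` {..<2 * k} \<inter> P' ` {0<..<m} = {}" using disj img imgP by simp
  qed
  then show ?thesis using img imgP c'0 by simp
qed

section \<open>Odd cycles through a prescribed vertex\<close>

text \<open>For irreflexive \<open>F\<close> the length is at least 3, since a one-vertex cycle
  would need a loop.\<close>

definition odd_cycle :: "('a \<Rightarrow> 'a \<Rightarrow> bool) \<Rightarrow> 'a list \<Rightarrow> bool" where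
  "odd_cycle F cs \<longleftrightarrow> odd (length cs) \<and> distinct cs \<and> successively F cs \<and> F (last cs) (hd cs)"

lemma odd_cycle_rotate:
  assumes "odd_cycle F cs" "z \<in> set cs"
  obtains zs where "odd_cycle F (z # zs)" "set (z # zs) = set cs"
proof -
  obtain us vs where "cs = us @ z # vs" using assms(2) by (meson split_list)
  then have "odd_cycle F (z # vs @ us)"
    using assms(1) by (cases "us = []") (auto simp: odd_cycle_def successively_append_iff successively_Cons hd_append)
  then show ?thesis using \<open>cs = us @ z # vs\<close> by (intro that[of "vs @ us"]) auto
qed

lemma odd_cycle_disjoint_levels:
  assumes "symp F" "odd_cycle F (v # vs)"
  shows "\<exists>a b. disjoint_levels (set (v # vs)) F v a b"
proof -
  let ?cs = "v # vs" let ?n = "length ?cs"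
  define c where "c i = ?cs ! (i mod ?n)" for i
  have oc: "distinct ?cs" "odd ?n" "successively F ?cs" "F (last ?cs) v"
    using assms(2) by (auto simp: odd_cycle_def)
  have inj: "inj_on c {..<?n}"
    using oc(1) by (auto simp: inj_on_def c_def nth_eq_iff_index_eq simp del: nth_Cons_Suc)
  have "F (c i) (c (Suc i))" if "i < ?n" for i
  proof (cases "Suc i = ?n")
    case True
    then have "c i = last ?cs" by (simp add: c_def last_conv_nth)
    then show ?thesis using oc(4) True by (simp add: c_def)
  next
    case False
    then show ?thesis using that oc(3) unfolding successively_conv_nth c_def by simp
  qed
  then have edge: "F (c i) (c (Suc i)) \<and> F (c (Suc i)) (c i)" if "i < ?n" for i
    using that assms(1) by (simp add: symp_def)
  have "c ` {..<?n} = set ?cs"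
    by (auto simp: c_def set_conv_nth simp del: nth_Cons_Suc)
  moreover obtain a b where "disjoint_levels (c ` {..<?n}) F (c 0) a b"
    using odd_cycle_levels[OF inj _ oc(2) edge] by (auto simp: c_def)
  ultimately show ?thesis by (auto simp: c_def)
qed

text \<open>An ear from \<^term>\<open>y\<close> back to the odd cycle closes up with either of the two arcs at
  \<^term>\<open>z\<close>; the arcs have different parities, so one of the two resulting cycles is odd.\<close>

lemma odd_cycle_step:
  assumes "symp F" "\<And>x. \<not> F x x" "odd_cycle F cs" "set cs \<subseteq> W" "z \<in> set cs" "F z y" "y \<in> W"
    "connected_graph (W - {z}) F"
  obtains cs' where "odd_cycle F cs'" "set cs' \<subseteq> W" "y \<in> set cs'"
proof (cases "y \<in> set cs")
  case True
  then show ?thesis using assms that by blast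
next
  case False
  obtain zs where zs: "odd_cycle F (z # zs)" "set (z # zs) = set cs"
    using odd_cycle_rotate[OF assms(3,5)] .
  have "zs \<noteq> []" using zs assms(2) by (auto simp: odd_cycle_def)
  have "hd zs \<in> W - {z}" using zs \<open>zs \<noteq> []\<close> assms(4) hd_in_set[of zs] by (auto simp: odd_cycle_def)
  moreover have "y \<in> W - {z}" using assms(5,7) False by auto
  \<comment> \<open>\<open>zs\<close> is the cycle without \<open>z\<close>. A path from
    \<open>y\<close> that avoids \<open>z\<close>, stopped at its first vertex \<open>w\<close> on
    \<open>zs\<close>, is the ear.\<close>
  ultimately have "reach (W - {z}) F y (hd zs)"
    using assms(8) by (auto intro: connected_reach)
  then obtain ys where ys: "ys \<noteq> []" "hd ys = y" "last ys \<in> set zs" "set (butlast ys) \<inter> set zs = {}"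
      "distinct ys" "set ys \<subseteq> W - {z}" "successively F ys"
    using reach_first_hit[of _ _ _ _ "set zs"] \<open>zs \<noteq> []\<close> by (metis hd_in_set)
  then obtain us vs where uv: "zs = us @ last ys # vs" by (meson split_list)
  define bs w where "bs = butlast ys" and "w = last ys"
  have ys_eq: "ys = bs @ [w]" using ys(1) by (simp add: bs_def w_def)
  have zs_eq: "zs = us @ w # vs" using uv by (simp add: w_def)
  have sym: "F a b \<Longrightarrow> F b a" for a b using assms(1) by (auto simp: symp_def)
  have sys: "successively F bs" "bs \<noteq> [] \<Longrightarrow> F (last bs) w" "F z (hd (bs @ [w]))"
    using ys(2,7) assms(6) by (auto simp: ys_eq successively_append_iff)
  have dis: "distinct bs" "w \<notin> set bs" "z \<notin> set bs" "z \<noteq> w" "set bs \<subseteq> W" "w \<in> W"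
    "set bs \<inter> set us = {}" "set bs \<inter> set vs = {}" "y \<in> set (bs @ [w])"
    using ys hd_in_set[OF ys(1)] by (auto simp: ys_eq zs_eq)
  have zo: "distinct us" "distinct vs" "w \<notin> set us" "w \<notin> set vs" "z \<notin> set us" "z \<notin> set vs"
    "set us \<subseteq> W" "set vs \<subseteq> W" "z \<in> W" "even (length us + length vs) = False"
    "successively F us" "successively F vs" "us \<noteq> [] \<Longrightarrow> F (last us) w" "vs \<noteq> [] \<Longrightarrow> F w (hd vs)"
    "F z (hd (us @ [w]))" "F (last (w # vs)) z"
    using zs assms(4) by (auto simp: odd_cycle_def zs_eq successively_append_iff successively_Cons hd_append)
  have rev_us: "successively (\<lambda>x y. F y x) us" "us \<noteq> [] \<Longrightarrow> F w (last us)"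
    "F (last (w # rev us)) z"
    using zo(11,13,15) sym by (auto simp: last_rev hd_append split: if_splits elim: successively_mono)
  show ?thesis
  proof (cases "odd (length (z # bs @ w # vs))")
    case True
    have oc: "odd_cycle F (z # bs @ w # vs)"
      using sys dis zo True by (auto simp: odd_cycle_def successively_append_iff successively_Cons hd_append)
    show ?thesis by (rule that[OF oc]) (use dis zo in auto)
  next
    case False
    have oc: "odd_cycle F (z # bs @ w # rev us)"
      using sys dis zo rev_us False
      by (auto simp: odd_cycle_def successively_append_iff successively_Cons hd_append hd_rev last_rev)
    show ?thesis by (rule that[OF oc]) (use dis zo in auto)
  qed
qed

text \<open>Every edge changes sides and there is one edge fewer than vertices, so the ends are on
  the same side exactly when the number of vertices is odd.\<close>

lemma alternating_path:
  assumes "\<And>x y. F x y \<Longrightarrow> x \<in> U \<Longrightarrow> y \<in> U \<Longrightarrow> (x \<in> X) \<noteq> (y \<in> X)"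
  shows "xs \<noteq> [] \<Longrightarrow> successively F xs \<Longrightarrow> set xs \<subseteq> U \<Longrightarrow>
    (last xs \<in> X) = ((hd xs \<in> X) = odd (length xs))"
proof (induction xs rule: induct_list012)
  case (3 x y zs)
  then show ?case using assms[of x y] by auto
qed auto

text \<open>Take a largest bipartite vertex set \<open>U\<close> and a vertex \<open>u\<close>
  outside it. Some component of \<open>U\<close> has neighbours of \<open>u\<close> on both sides,
  since otherwise the sides could be swapped componentwise to accommodate \<open>u\<close>; a path
  between two such neighbours closes up at \<open>u\<close> to an odd cycle.\<close>

lemma odd_cycle_exists:
  assumes "finite W" "symp F" "\<And>x. \<not> F x x" "\<not> bipartite W F"
  obtains cs where "odd_cycle F cs" "set cs \<subseteq> W"
proof -
  have "bipartite {} F" by (auto simp: bipartite_def)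
  then obtain U where U: "U \<subseteq> W" "bipartite U F"
    and max: "\<And>U'. U' \<subseteq> W \<Longrightarrow> bipartite U' F \<Longrightarrow> card U' \<le> card U"
    using ex_has_greatest_nat[of "\<lambda>U. U \<subseteq> W \<and> bipartite U F" "{}" card "Suc (card W)"] assms(1)
    by (metis card_mono empty_subsetI less_Suc_eq_le)
  have sym: "F a b \<Longrightarrow> F b a" for a b using assms(2) by (auto simp: symp_def)
  have "U \<noteq> W" using U assms(4) by auto
  then obtain u where u: "u \<in> W" "u \<notin> U" using U(1) by blast
  have nb: "\<not> bipartite (insert u U) F"
  proof
    assume "bipartite (insert u U) F"
    then have "card (insert u U) \<le> card U" using max U u by simp
    then show False using u U assms(1) by (simp add: finite_subset)
  qed
  obtain X Y where XY: "X \<inter> Y = {}" "X \<union> Y = U"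
    and e: "\<And>x y. F x y \<Longrightarrow> x \<in> U \<Longrightarrow> y \<in> U \<Longrightarrow> (x \<in> X \<and> y \<in> Y) \<or> (x \<in> Y \<and> y \<in> X)"
    using U(2) unfolding bipartite_def by blast
  have "\<exists>x\<in>X. \<exists>y\<in>Y. F u x \<and> F u y \<and> reach U F x y"
  proof (rule ccontr)
    assume "\<not> ?thesis"
    then have no: "\<And>x y. x \<in> X \<Longrightarrow> y \<in> Y \<Longrightarrow> F u x \<Longrightarrow> F u y \<Longrightarrow> \<not> reach U F y x"
      using reach_sym[OF assms(2)] by blast
    \<comment> \<open>\<open>R\<close> is the union of the components of \<open>U\<close> with a
      neighbour of \<open>u\<close> in \<open>Y\<close>. Swapping the sides on \<open>R\<close>
      moves all neighbours of \<open>u\<close> to one side.\<close>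
    define R where "R = {z \<in> U. \<exists>y\<in>Y. F u y \<and> reach U F y z}"
    have R: "x \<in> R \<longleftrightarrow> y \<in> R" if "F x y" "x \<in> U" "y \<in> U" for x y
    proof -
      have "reach U F x y" "reach U F y x" using that sym by (auto intro: reach_edge)
      then show ?thesis using that reach_trans unfolding R_def by (smt (verit) mem_Collect_eq)
    qed
    have RX: "x \<notin> R" if "F u x" "x \<in> X" for x using that no unfolding R_def by blast
    have RY: "y \<in> R" if "F u y" "y \<in> Y" for y using that XY reach_refl[of y U F] unfolding R_def by blast
    let ?X = "(X - R) \<union> (Y \<inter> R)" let ?Y = "insert u ((Y - R) \<union> (X \<inter> R))"
    have "(x \<in> ?X \<and> y \<in> ?Y) \<or> (x \<in> ?Y \<and> y \<in> ?X)" if "F x y" "x \<in> insert u U" "y \<in> insert u U" for x y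
    proof -
      consider "x = u" "y = u" | "x = u" "y \<in> U" | "y = u" "x \<in> U" | "x \<in> U" "y \<in> U"
        using \<open>x \<in> insert u U\<close> \<open>y \<in> insert u U\<close> by blast
      then show ?thesis
      proof cases
        case 1 then show ?thesis using that assms(3) by blast
      next
        case 2 then show ?thesis using that RX RY XY by blast
      next
        case 3 then show ?thesis using sym[OF that(1)] RX RY XY by blast
      next
        case 4 then show ?thesis using e[OF that(1)] R[OF that(1)] by blast
      qed
    qed
    moreover have "?X \<inter> ?Y = {}" "?X \<union> ?Y = insert u U" using XY u by auto
    ultimately have "bipartite (insert u U) F" unfolding bipartite_def by blast
    then show False using nb by blast
  qed
  then obtain x y where xy: "x \<in> X" "y \<in> Y" "F u x" "F u y" "reach U F x y" by blast
  then obtain xs where xs: "xs \<noteq> []" "hd xs = x" "last xs = y" "distinct xs" "set xs \<subseteq> U" "successively F xs"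
    using reach_path by metis
  have "(last xs \<in> X) = ((hd xs \<in> X) = odd (length xs))"
    using alternating_path[of F U X xs] e XY xs by blast
  then have "even (length xs)" using xs xy XY by auto
  then have "odd_cycle F (u # xs)"
    using xs xy u sym by (auto simp: odd_cycle_def successively_Cons)
  then show ?thesis using that xs u U by auto
qed

text \<open>Lying on an odd cycle is passed on to neighbours by \<open>odd_cycle_step\<close>, and
  thus along a path from any odd cycle to \<open>v\<close>.\<close>

lemma odd_cycle_through:
  assumes "two_connected W F" "symp F" "\<And>x. \<not> F x x" "\<not> bipartite W F" "v \<in> W"
  obtains vs where "odd_cycle F (v # vs)" "set (v # vs) \<subseteq> W"
proof -
  have W: "finite W" "connected_graph W F" "\<And>x. x \<in> W \<Longrightarrow> connected_graph (W - {x}) F"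
    using assms(1) by (auto simp: two_connected_def)
  obtain cs where cs: "odd_cycle F cs" "set cs \<subseteq> W" using odd_cycle_exists W assms by metis
  then have "hd cs \<in> W" by (cases cs) (auto simp: odd_cycle_def)
  then have "reach W F (hd cs) v" using W assms by (auto intro: connected_reach)
  then have "\<exists>cs. odd_cycle F cs \<and> set cs \<subseteq> W \<and> v \<in> set cs"
  proof (induction rule: reach_induct)
    case base
    have "hd cs \<in> set cs" using cs by (cases cs) (auto simp: odd_cycle_def)
    then show ?case using cs by blast
  next
    case (step y z)
    then obtain cs where "odd_cycle F cs" "set cs \<subseteq> W" "y \<in> set cs" by blast
    then show ?case
      using odd_cycle_step[OF assms(2,3) _ _ _ \<open>F y z\<close> \<open>z \<in> W\<close>] W(3) by (metis subsetD)
  qed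
  then obtain cs where "odd_cycle F cs" "set cs \<subseteq> W" "v \<in> set cs" by blast
  then show ?thesis using odd_cycle_rotate that by metis
qed

section \<open>Even cycles with a separating chordal path\<close>

lemma symp_cycle_adj: "symp (cycle_adj cs)"
  unfolding symp_def cycle_adj_def by blast

lemma reach_along_cycle:
  assumes "i \<le> j" "j < length cs" "\<And>l. i \<le> l \<Longrightarrow> l \<le> j \<Longrightarrow> cs ! l \<in> R"
  shows "reach R (cycle_adj cs) (cs ! i) (cs ! j)"
  using assms
proof (induction j rule: dec_induct)
  case base
  then show ?case by (simp add: reach_refl)
next
  case (step j)
  have "cycle_adj cs (cs ! j) (cs ! Suc j)"
    using step.prems unfolding cycle_adj_def by (intro exI[of _ j]) auto
  then have "reach R (cycle_adj cs) (cs ! j) (cs ! Suc j)"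
    using step by (intro reach_edge) auto
  then show ?case using step by (metis Suc_lessD le_Suc_eq reach_trans)
qed

text \<open>Translates the lists into index functions for \<open>theta_levels\<close>. Reducing
  indices modulo \<open>2 * k\<close> gives \<open>c (2 * k) = c 0\<close>, and chordality keeps the
  interior of the path off the cycle.\<close>

lemma theta_disjoint_levels_aux:
  assumes "symp F" "is_cycle W F cs" "length cs = 2 * k" "is_path W F ps" "chordal_path ps cs"
    "hd ps = cs ! p" "last ps = cs ! q" "0 < p" "p < k" "k < q" "q < 2 * k"
  shows "\<exists>D a b. D \<subseteq> W \<and> D \<noteq> {cs ! 0} \<and> disjoint_levels D F (cs ! 0) a b"
proof -
  define c where "c i = cs ! (i mod (2 * k))" for i
  define m where "m = length ps - 1"
  have cs: "distinct cs" "set cs \<subseteq> W" "\<And>i. i < 2 * k \<Longrightarrow> F (cs ! i) (cs ! ((i + 1) mod (2 * k)))"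
    using assms(2,3) by (auto simp: is_cycle_def)
  have ps: "ps \<noteq> []" "distinct ps" "set ps \<subseteq> W" "\<And>i. i + 1 < length ps \<Longrightarrow> F (ps ! i) (ps ! (i + 1))"
    using assms(4) by (auto simp: is_path_def)
  have sym: "F a b \<Longrightarrow> F b a" for a b using assms(1) by (auto simp: symp_def)
  have inj: "inj_on c {..<2*k}"
    using cs(1) assms(3) by (auto simp: inj_on_def c_def nth_eq_iff_index_eq)
  have img: "c ` {..<2*k} = set cs"
    using assms(3) by (auto simp: c_def set_conv_nth)
  have edge: "F (c i) (c (Suc i)) \<and> F (c (Suc i)) (c i)" if "i < 2*k" for i
    using cs(3)[OF that] sym that by (simp add: c_def)
  have edgeP: "F (ps ! j) (ps ! Suc j) \<and> F (ps ! Suc j) (ps ! j)" if "j < m" for j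
    using ps(4)[of j] sym that by (simp add: m_def)
  have injP: "inj_on ((!) ps) {0<..<m}"
    using ps(2) by (auto simp: inj_on_def m_def nth_eq_iff_index_eq)
  have "ps ! j \<notin> set cs" if j: "j \<in> {0<..<m}" for j
  proof
    assume "ps ! j \<in> set cs"
    moreover have "ps ! j \<in> set ps" using j by (auto simp: m_def)
    ultimately have "ps ! j \<in> {hd ps, last ps}" using assms(5) unfolding chordal_path_def by blast
    then have "ps ! j = ps ! 0 \<or> ps ! j = ps ! m"
      using ps(1) by (auto simp: hd_conv_nth last_conv_nth m_def)
    then have "j = 0 \<or> j = m"
      using j ps(1,2) by (auto simp: nth_eq_iff_index_eq m_def)
    then show False using j by auto
  qed
  then have disj: "c ` {..<2*k} \<inter> (!) ps ` {0<..<m} = {}" unfolding img by auto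
  obtain a b where "disjoint_levels (c ` {..<2*k} \<union> (!) ps ` {0<..<m}) F (c 0) a b"
    using theta_levels[where P = "(!) ps" and m = m, OF inj _ edge assms(8-11) _ _ edgeP injP disj] assms(6-11) ps(1)
    by (auto simp: c_def m_def hd_conv_nth last_conv_nth)
  moreover have "c ` {..<2*k} \<union> (!) ps ` {0<..<m} \<subseteq> W"
    using img cs(2) ps(3) by (auto simp: m_def intro!: subsetD[OF ps(3)])
  moreover have "c 1 \<noteq> c 0" using inj_onD[OF inj, of 1 0] assms(8-11) by auto
  then have "c ` {..<2*k} \<union> (!) ps ` {0<..<m} \<noteq> {c 0}"
    using imageI[of 1 "{..<2*k}" c] assms(8-11) by auto
  moreover have "c 0 = cs ! 0" by (simp add: c_def)
  ultimately show ?thesis by metis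
qed

text \<open>If both ends of the path had indices on the same side of \<open>k\<close>, the other arc
  between \<open>cs ! 0\<close> and the antipode would survive their deletion. The arc above
  \<open>k\<close> needs the closing edge from index \<open>2 * k - 1\<close> to 0.\<close>

lemma separates_indices:
  assumes "distinct cs" "length cs = 2 * k" "separates ps cs (cs ! 0) (antipode cs)"
    "hd ps = cs ! p" "last ps = cs ! q" "p < 2 * k" "q < 2 * k"
  shows "0 < p \<and> 0 < q \<and> (p < k \<and> k < q \<or> q < k \<and> k < p)"
proof -
  define R where "R = set cs - {hd ps, last ps}"
  have k: "0 < k" using assms(6) by simp
  have sep: "cs ! 0 \<in> R" "cs ! k \<in> R" and no: "\<not> reach R (cycle_adj cs) (cs ! 0) (cs ! k)"
    using assms(2,3) by (auto simp: separates_def antipode_def R_def Let_def)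
  have ne: "0 \<noteq> p" "0 \<noteq> q" "k \<noteq> p" "k \<noteq> q"
    using sep unfolding R_def assms(4,5) by (metis Diff_iff insertCI)+
  have mem: "cs ! l \<in> R" if "l < 2 * k" "l \<noteq> p" "l \<noteq> q" for l
    using that assms by (auto simp: R_def nth_eq_iff_index_eq)
  have False if "p < k" "q < k"
  proof -
    have "reach R (cycle_adj cs) (cs ! k) (cs ! (2 * k - 1))"
      using that assms(2) k by (intro reach_along_cycle mem) auto
    moreover have "reach R (cycle_adj cs) (cs ! (2 * k - 1)) (cs ! 0)"
    proof (intro reach_edge mem)
      show "cycle_adj cs (cs ! (2 * k - 1)) (cs ! 0)"
        using assms(2) k unfolding cycle_adj_def by (intro exI[of _ "2 * k - 1"]) auto
    qed (use that ne k in auto)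
    ultimately show False
      using no reach_trans reach_sym[OF symp_cycle_adj] by metis
  qed
  moreover have False if "k < p" "k < q"
    using no that assms(2) ne k reach_along_cycle[of 0 k cs R] mem by auto
  ultimately show ?thesis using ne nat_neq_iff[of p k] nat_neq_iff[of q k] gr0I[of p] gr0I[of q] by metis
qed

lemma theta_disjoint_levels:
  assumes "symp F" "is_cycle W F cs" "even (length cs)" "is_path W F ps" "chordal_path ps cs"
    "separates ps cs (cs ! 0) (antipode cs)"
  shows "\<exists>D a b. D \<subseteq> W \<and> D \<noteq> {cs ! 0} \<and> disjoint_levels D F (cs ! 0) a b"
proof -
  obtain k where k: "length cs = 2 * k" using assms(3) by (auto elim: evenE)
  have "hd ps \<in> set cs" "last ps \<in> set cs"
    using assms(5) unfolding chordal_path_def by auto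
  then obtain p q where pq: "hd ps = cs ! p" "last ps = cs ! q" "p < 2 * k" "q < 2 * k"
    using k by (metis in_set_conv_nth)
  have cs: "distinct cs" using assms(2) by (simp add: is_cycle_def)
  have ps: "ps \<noteq> []" using assms(4) by (simp add: is_path_def)
  from separates_indices[OF cs k assms(6) pq]
  consider "0 < p" "p < k" "k < q" | "0 < q" "q < k" "k < p" by blast
  then show ?thesis
  proof cases
    case 1
    then show ?thesis using theta_disjoint_levels_aux[OF assms(1,2) k assms(4,5) pq(1,2)] pq by blast
  next
    case 2
    have "successively (\<lambda>x y. F y x) ps"
      using assms(1,4) by (auto simp: is_path_iff_successively symp_def elim: successively_mono)
    then have "is_path W F (rev ps)"
      using assms(4) by (simp add: is_path_iff_successively)
    moreover have "chordal_path (rev ps) cs"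
      using assms(5) ps by (auto simp: chordal_path_def hd_rev last_rev)
    ultimately show ?thesis
      using theta_disjoint_levels_aux[OF assms(1,2) k, of "rev ps" q p] 2 pq ps
      by (simp add: hd_rev last_rev)
  qed
qed

section \<open>Blocks\<close>

lemma reach_cong:
  assumes "\<And>x y. x \<in> W \<Longrightarrow> y \<in> W \<Longrightarrow> F x y = F' x y"
  shows "reach W F = reach W F'"
proof -
  have "(\<lambda>a b. F a b \<and> a \<in> W \<and> b \<in> W) = (\<lambda>a b. F' a b \<and> a \<in> W \<and> b \<in> W)"
    using assms by (auto simp: fun_eq_iff)
  then show ?thesis unfolding reach_def by simp
qed

text \<open>Blocks turn out to have this form, so statements about their edge relation become
  statements about \<open>E\<close> on a vertex set.\<close>

definition induced :: "('a \<Rightarrow> 'a \<Rightarrow> bool) \<Rightarrow> 'a set \<Rightarrow> 'a \<Rightarrow> 'a \<Rightarrow> bool" where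
  "induced E U x y \<longleftrightarrow> E x y \<and> x \<in> U \<and> y \<in> U"

lemma reach_induced: "W \<subseteq> U \<Longrightarrow> reach W (induced E U) = reach W E"
  by (rule reach_cong) (auto simp: induced_def)

lemma connected_induced: "W \<subseteq> U \<Longrightarrow> connected_graph W (induced E U) = connected_graph W E"
  by (simp add: connected_graph_def reach_induced)

lemma cut_vertex_induced: "cut_vertex U (induced E U) x = cut_vertex U E x"
proof -
  have "reach (U - {x}) (induced E U) = reach (U - {x}) E" by (rule reach_induced) auto
  then show ?thesis by (simp add: cut_vertex_def)
qed

lemma subgraph_induced: "simple_graph V E \<Longrightarrow> U \<subseteq> V \<Longrightarrow> subgraph U (induced E U) V E"
  by (auto simp: subgraph_def induced_def simple_graph_def)

lemma connected_mono:
  assumes "connected_graph W F" "\<And>x y. F x y \<Longrightarrow> E x y"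
  shows "connected_graph W E"
  using assms reach_mono[of W F _ _ W E] unfolding connected_graph_def by blast

lemma cut_vertex_antimono:
  assumes "cut_vertex W E x" "\<And>x y. F x y \<Longrightarrow> E x y"
  shows "cut_vertex W F x"
  using assms reach_mono[of "W - {x}" F _ _ "W - {x}" E] unfolding cut_vertex_def by blast

text \<open>Adding all edges of \<open>E\<close> inside \<open>W\<close> preserves connectedness and
  creates no cut vertex, so maximality says they were already present.\<close>

lemma block_induced:
  assumes "simple_graph V E" "is_block V E W F"
  shows "F = induced E W"
proof -
  have W: "subgraph W F V E" "connected_graph W F" "\<And>x. \<not> cut_vertex W F x"
    and max: "\<And>F'. subgraph W F' V E \<Longrightarrow> connected_graph W F' \<Longrightarrow> (\<forall>x. \<not> cut_vertex W F' x) \<Longrightarrow>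
      (\<forall>x y. F x y \<longrightarrow> F' x y) \<Longrightarrow> F' = F"
    using assms(2) unfolding is_block_def by blast+
  have sub: "W \<subseteq> V" "\<And>x y. F x y \<Longrightarrow> induced E W x y"
    using W(1) by (auto simp: subgraph_def induced_def)
  have "connected_graph W (induced E W)"
    using W(2) sub(2) by (rule connected_mono)
  moreover have "\<not> cut_vertex W (induced E W) x" for x
    using W(3) sub(2) cut_vertex_antimono by metis
  ultimately show ?thesis
    using max[of "induced E W"] subgraph_induced[OF assms(1) sub(1)] sub(2) by blast
qed

lemma block_props:
  assumes "simple_graph V E" "is_block V E W F"
  shows "W \<subseteq> V" "connected_graph W E" "\<not> cut_vertex W E x"
  using assms(2) block_induced[OF assms]
  by (auto simp: is_block_def subgraph_def connected_induced cut_vertex_induced)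

lemma block_connected_minus:
  assumes "simple_graph V E" "is_block V E W F" "u \<in> W - {c}" "w \<in> W - {c}"
  shows "reach (W - {c}) E u w"
proof (cases "c \<in> W")
  case True
  then show ?thesis using assms(3,4) block_props(3)[OF assms(1,2)] unfolding cut_vertex_def by blast
next
  case False
  then have "W - {c} = W" by blast
  then show ?thesis using assms(3,4) block_props(2)[OF assms(1,2)] by (simp add: connected_reach)
qed

lemma block_maximal:
  assumes "simple_graph V E" "is_block V E W F" "W \<subseteq> W'" "W' \<subseteq> V" "connected_graph W' E"
    "\<And>x. \<not> cut_vertex W' E x"
  shows "W' = W"
proof -
  have "\<forall>x y. F x y \<longrightarrow> induced E W' x y"
    using block_induced[OF assms(1,2)] assms(3) by (auto simp: induced_def)
  then show ?thesis
    using assms subgraph_induced[OF assms(1,4)]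
    unfolding is_block_def by (metis connected_induced cut_vertex_induced order_refl)
qed

text \<open>The single edge is connected without a cut vertex; a largest vertex set containing it
  with these two properties induces a block.\<close>

lemma block_exists:
  assumes "simple_graph V E" "E u w"
  obtains W F where "is_block V E W F" "u \<in> W" "w \<in> W"
proof -
  have fin: "finite V" and uw: "u \<in> V" "w \<in> V" "u \<noteq> w" "E w u"
    using assms by (auto simp: simple_graph_def)
  define P where "P U \<longleftrightarrow> U \<subseteq> V \<and> u \<in> U \<and> w \<in> U \<and> connected_graph U E \<and> (\<forall>x. \<not> cut_vertex U E x)" for U
  have "reach {u, w} E x y" if "x \<in> {u, w}" "y \<in> {u, w}" for x y
    using that reach_refl[of u "{u, w}" E] reach_refl[of w "{u, w}" E]
      reach_edge[where F = E, OF assms(2), of "{u, w}"] reach_edge[where F = E, OF uw(4), of "{u, w}"]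
    by blast
  moreover have "\<not> cut_vertex {u, w} E x" for x
    using reach_refl[of u "{u, w} - {x}" E] reach_refl[of w "{u, w} - {x}" E]
    by (auto simp: cut_vertex_def)
  ultimately have "P {u, w}"
    using uw by (auto simp: P_def connected_graph_def)
  moreover have "\<forall>U. P U \<longrightarrow> card U < Suc (card V)"
    using fin by (auto simp: P_def less_Suc_eq_le card_mono)
  ultimately obtain U where U: "P U" and max: "\<And>U'. P U' \<Longrightarrow> card U' \<le> card U"
    using ex_has_greatest_nat[of P "{u, w}" card] by (metis less_imp_le)
  have "is_block V E U (induced E U)"
    unfolding is_block_def
  proof (intro conjI allI impI)
    show "subgraph U (induced E U) V E" using U by (simp add: P_def subgraph_induced assms(1))
    show "connected_graph U (induced E U)" using U by (simp add: P_def connected_induced)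
    show "\<not> cut_vertex U (induced E U) x" for x using U by (simp add: P_def cut_vertex_induced)
    fix W' F'
    assume *: "subgraph W' F' V E \<and> connected_graph W' F' \<and> (\<forall>x. \<not> cut_vertex W' F' x) \<and>
              U \<subseteq> W' \<and> (\<forall>x y. induced E U x y \<longrightarrow> F' x y)"
    then have sub: "\<And>x y. F' x y \<Longrightarrow> E x y" "W' \<subseteq> V" by (auto simp: subgraph_def)
    have "P W'"
      using * U connected_mono[of W' F' E] cut_vertex_antimono[of W' E _ F'] sub
      unfolding P_def by blast
    then have "card W' \<le> card U" using max by blast
    then show WU: "W' = U" using * sub fin by (metis card_seteq finite_subset)
    have "F' x y = induced E U x y" for x y
      using * unfolding WU subgraph_def induced_def by blast
    then show "F' = induced E U" by blast
  qed
  then show ?thesis using that U by (simp add: P_def)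
qed

text \<open>Adding to a block a path between two of its vertices creates no cut vertex, since deleting a
  vertex of the path leaves both of its pieces attached to the block.\<close>

lemma path_in_block:
  assumes G: "simple_graph V E" and B: "is_block V E W F"
    and xs: "xs \<noteq> []" "distinct xs" "set xs \<subseteq> V" "successively E xs" "hd xs \<in> W" "last xs \<in> W"
  shows "set xs \<subseteq> W"
proof -
  let ?W = "W \<union> set xs"
  have sym: "symp E" using G by (auto simp: simple_graph_def symp_def)
  \<comment> \<open>With \<open>C\<close> empty this serves connectedness, with
    \<open>C = {c}\<close> the absence of cut vertices.\<close>
  have to_block: "\<exists>w\<in>W - C. reach (?W - C) E y w" if y: "y \<in> ?W - C" and C: "C = {} \<or> C = {c}" for y C c
  proof (cases "y \<in> W")
    case True
    then show ?thesis using y reach_refl by (metis Diff_iff)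
  next
    case False
    then obtain us vs where uv: "xs = us @ y # vs" using y by (metis DiffD1 UnE split_list)
    \<comment> \<open>The path is simple and \<open>y\<close> is not deleted, so \<open>c\<close>
      can lie on only one of the two pieces at \<open>y\<close>.\<close>
    consider "set (us @ [y]) \<inter> C = {}" | "set (y # vs) \<inter> C = {}"
      using C y xs(2) uv by auto
    then show ?thesis
    proof cases
      case 1
      have "successively E (us @ [y])"
        using xs(4) uv by (auto simp: successively_append_iff successively_Cons)
      moreover have "set (us @ [y]) \<subseteq> ?W - C" using 1 uv by auto
      ultimately have "reach (?W - C) E (hd (us @ [y])) (last (us @ [y]))"
        by (rule successively_reach) simp
      then have "reach (?W - C) E (hd xs) y" using uv by (cases us) auto
      moreover have "hd xs \<in> W - C" using 1 xs(5) uv by (cases us) auto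
      ultimately show ?thesis using reach_sym[OF sym] by blast
    next
      case 2
      have "successively E (y # vs)"
        using xs(4) uv by (auto simp: successively_append_iff)
      moreover have "set (y # vs) \<subseteq> ?W - C" using 2 uv by auto
      ultimately have "reach (?W - C) E (hd (y # vs)) (last (y # vs))"
        by (rule successively_reach) simp
      then have "reach (?W - C) E y (last xs)" using uv by simp
      moreover have "last xs \<in> W - C" using 2 xs(6) uv last_in_set[of "y # vs"] by auto
      ultimately show ?thesis by blast
    qed
  qed
  have conn: "reach (?W - C) E x y" if xyC: "x \<in> ?W - C" "y \<in> ?W - C" "C = {} \<or> C = {c}" for x y C c
  proof -
    obtain x' y' where x': "x' \<in> W - C" "reach (?W - C) E x x'" and y': "y' \<in> W - C" "reach (?W - C) E y y'"
      using to_block[OF xyC(1,3)] to_block[OF xyC(2,3)] by blast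
    have "reach (W - C) E x' y'"
      using that(3) x'(1) y'(1) block_connected_minus[OF G B] block_props(2)[OF G B]
      by (auto intro: connected_reach)
    then have "reach (?W - C) E x' y'" by (rule reach_mono) auto
    then show ?thesis using x' y' reach_trans reach_sym[OF sym] by metis
  qed
  have "?W = W"
  proof (rule block_maximal[OF G B])
    show "?W \<subseteq> V" using block_props(1)[OF G B] xs(3) by auto
    show "connected_graph ?W E"
      using conn[of _ "{}"] xs(5) unfolding connected_graph_def by auto
    show "\<not> cut_vertex ?W E x" for x
      using conn[of _ "{x}"] unfolding cut_vertex_def by blast
  qed auto
  then show ?thesis by blast
qed

section \<open>Restricting level functions to blocks and assembling them from blocks\<close>

text \<open>Following lower neighbours down to \<open>v\<close> gives the path. The bound on the
  levels shows that a vertex one level higher is new and can be appended.\<close>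

lemma levels_path:
  assumes "levels V E v a" "x \<in> V"
  shows "\<exists>xs. xs \<noteq> [] \<and> distinct xs \<and> set xs \<subseteq> V \<and> successively E xs \<and> hd xs = v \<and> last xs = x \<and>
    (\<forall>y\<in>set xs. a y \<le> a x)"
  using assms(2)
proof (induction "a x" arbitrary: x)
  case 0
  then have "x = v" using levels_eq_0[OF assms(1)] by simp
  then show ?case using 0 by (intro exI[of _ "[v]"]) auto
next
  case (Suc n)
  then obtain y where y: "y \<in> V" "E y x" "a x = Suc (a y)"
    using assms(1) unfolding levels_def by (metis Diff_iff nat.distinct(1) singletonD)
  then obtain xs where xs: "xs \<noteq> []" "distinct xs" "set xs \<subseteq> V" "successively E xs" "hd xs = v"
    "last xs = y" "\<And>z. z \<in> set xs \<Longrightarrow> a z \<le> a y"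
    using Suc by (metis Suc_inject)
  have "x \<notin> set xs" using xs(7)[of x] y by auto
  then show ?case using xs y Suc.prems
    by (intro exI[of _ "xs @ [x]"]) (auto simp: successively_append_iff intro: le_SucI)
qed

text \<open>A descending path from \<open>x\<close> to \<open>v\<close> joins two vertices of the
  block and stays inside by \<open>path_in_block\<close>; hence a lower neighbour of
  \<open>x\<close> lies in the block too.\<close>

lemma levels_block:
  assumes "simple_graph V E" "is_block V E W F" "levels V E v a" "v \<in> W"
  shows "levels W F v a"
proof -
  have "\<exists>y\<in>W. F y x \<and> a x = Suc (a y)" if x: "x \<in> W - {v}" for x
  proof -
    have "x \<in> V" using x block_props(1)[OF assms(1,2)] by auto
    then obtain y where y: "y \<in> V" "E y x" "a x = Suc (a y)"
      using assms(3) x unfolding levels_def by blast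
    obtain xs where xs: "xs \<noteq> []" "distinct xs" "set xs \<subseteq> V" "successively E xs" "hd xs = v"
      "last xs = y" "\<And>z. z \<in> set xs \<Longrightarrow> a z \<le> a y"
      using levels_path[OF assms(3) y(1)] by blast
    have "x \<notin> set xs" using xs(7)[of x] y by auto
    then have "set (xs @ [x]) \<subseteq> W"
      using xs y x \<open>x \<in> V\<close> assms(4)
      by (intro path_in_block[OF assms(1,2)]) (auto simp: successively_append_iff)
    moreover have "y \<in> set xs" using xs(1,6) by auto
    ultimately show ?thesis
      using y by (auto simp: block_induced[OF assms(1,2)] induced_def)
  qed
  then show ?thesis using assms(3,4) unfolding levels_def by blast
qed

lemma disjoint_levels_extend:
  assumes "disjoint_levels H E v a b" "y \<in> H" "y \<noteq> v" "E y x" "x \<notin> H"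
  shows "disjoint_levels (insert x H) E v (a(x := Suc (a y))) (b(x := Suc (b y)))"
proof -
  have "levels (insert x H) E v (a(x := Suc (a y)))" if a: "levels H E v a" for a
    unfolding levels_def
  proof (intro conjI ballI)
    fix z assume z: "z \<in> insert x H - {v}"
    show "\<exists>w\<in>insert x H. E w z \<and> (a(x := Suc (a y))) z = Suc ((a(x := Suc (a y))) w)"
    proof (cases "z = x")
      case True
      then show ?thesis using assms by (intro bexI[of _ y]) auto
    next
      case False
      then obtain w where "w \<in> H" "E w z" "a z = Suc (a w)" using a z unfolding levels_def by blast
      then show ?thesis using False assms(5) by (intro bexI[of _ w]) auto
    qed
  qed (use a assms(5) in \<open>auto simp: levels_def\<close>)
  then show ?thesis
    using assms unfolding disjoint_levels_def by auto
qed

lemma disjoint_levels_glue: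
  assumes "disjoint_levels H E v a b" "disjoint_levels D E v a' b'" "H \<inter> D = {v}"
  shows "disjoint_levels (H \<union> D) E v (\<lambda>x. if x \<in> H then a x else a' x) (\<lambda>x. if x \<in> H then b x else b' x)"
proof -
  have glue: "levels (H \<union> D) E v (\<lambda>x. if x \<in> H then a x else a' x)"
    if a: "levels H E v a" "levels D E v a'" for a a'
    unfolding levels_def
  proof (intro conjI ballI)
    fix z assume z: "z \<in> H \<union> D - {v}"
    show "\<exists>w\<in>H \<union> D. E w z \<and> (if z \<in> H then a z else a' z) = Suc (if w \<in> H then a w else a' w)"
    proof (cases "z \<in> H")
      case True
      then show ?thesis using z a(1) unfolding levels_def by fastforce
    next
      case False
      then obtain w where w: "w \<in> D" "E w z" "a' z = Suc (a' w)" using a(2) z unfolding levels_def by blast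
      have "(if w \<in> H then a w else a' w) = a' w"
      proof (cases "w \<in> H")
        case True
        then have "w = v" using w(1) assms(3) by blast
        then show ?thesis using a by (simp add: levels_def)
      qed simp
      then show ?thesis using False w by (intro bexI[of _ w]) auto
    qed
  qed (use a in \<open>auto simp: levels_def\<close>)
  then show ?thesis
    using assms unfolding disjoint_levels_def by auto
qed

text \<open>A largest vertex set carrying disjoint levels is closed under neighbours of vertices other
  than \<^term>\<open>v\<close>; if it is not everything, it misses a whole block at \<^term>\<open>v\<close>.\<close>

lemma disjoint_levels_from_blocks:
  assumes G: "simple_graph V E" "connected_graph V E" "v \<in> V"
    and blocks: "\<And>W F. is_block V E W F \<Longrightarrow> v \<in> W \<Longrightarrow>
      \<exists>D a b. D \<subseteq> W \<and> D \<noteq> {v} \<and> disjoint_levels D F v a b"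
  shows "\<exists>a b. disjoint_levels V E v a b"
proof -
  have fin: "finite V" and sym: "symp E" using G(1) by (auto simp: simple_graph_def symp_def)
  define P where "P H \<longleftrightarrow> H \<subseteq> V \<and> (\<exists>a b. disjoint_levels H E v a b)" for H
  have "disjoint_levels {v} E v (\<lambda>_. 0) (\<lambda>_. 0)" by (simp add: disjoint_levels_def levels_def)
  then have "P {v}" using G(3) unfolding P_def by blast
  moreover have "\<forall>U. P U \<longrightarrow> card U < Suc (card V)"
    using fin by (auto simp: P_def less_Suc_eq_le card_mono)
  ultimately obtain H where H: "P H" and max: "\<And>H'. P H' \<Longrightarrow> card H' \<le> card H"
    using ex_has_greatest_nat[of P "{v}" card] by (metis less_imp_le)
  have max': "H' = H" if "P H'" "H \<subseteq> H'" for H'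
    using that max[of H'] fin by (metis P_def card_seteq finite_subset)
  obtain a b where HV: "H \<subseteq> V" and ab: "disjoint_levels H E v a b" using H P_def by blast
  have vH: "v \<in> H" using ab by (simp add: disjoint_levels_def levels_def)
  have closed: "x \<in> H" if "y \<in> H" "y \<noteq> v" "E y x" for x y
  proof (rule ccontr)
    assume "x \<notin> H"
    moreover have "x \<in> V" using that G(1) by (auto simp: simple_graph_def)
    ultimately have "P (insert x H)"
      using disjoint_levels_extend[OF ab that] HV unfolding P_def by blast
    then show False using max' \<open>x \<notin> H\<close> by blast
  qed
  have "H = V"
  proof (rule ccontr)
    assume "H \<noteq> V"
    then obtain y where y: "y \<in> V" "y \<notin> H" using HV by blast
    \<comment> \<open>If all neighbours of \<open>v\<close> were in \<open>H\<close>, then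
      \<open>closed\<close> and connectedness would put every vertex into \<open>H\<close>.\<close>
    have "\<exists>x. x \<notin> H \<and> E v x"
    proof (rule ccontr)
      assume no: "\<not> ?thesis"
      have "reach V E v y" using G y by (auto intro: connected_reach)
      then have "y \<in> H" by (induction rule: reach_induct) (use vH closed no in blast)+
      then show False using y by blast
    qed
    then obtain x where x: "x \<notin> H" "E v x" by blast
    obtain W F where W: "is_block V E W F" "v \<in> W" "x \<in> W" using block_exists[OF G(1) x(2)] .
    obtain D a' b' where D: "D \<subseteq> W" "D \<noteq> {v}" "disjoint_levels D F v a' b'"
      using blocks[OF W(1,2)] by blast
    have "D \<subseteq> V" using D(1) block_props(1)[OF G(1) W(1)] by blast
    have D': "disjoint_levels D E v a' b'"
      using D(3) by (rule disjoint_levels_mono) (simp add: block_induced[OF G(1) W(1)] induced_def)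
    have vD: "v \<in> D" using D(3) by (simp add: disjoint_levels_def levels_def)
    \<comment> \<open>Otherwise a path from \<open>h\<close> to \<open>x\<close> inside the block
      and off \<open>v\<close> would carry membership in \<open>H\<close> over to
      \<open>x\<close>.\<close>
    have "h \<notin> H" if h: "h \<in> W - {v}" for h
    proof
      assume "h \<in> H"
      have "reach (W - {v}) E h x"
        using x h W vH by (intro block_connected_minus[OF G(1) W(1)]) auto
      then have "x \<in> H \<and> x \<noteq> v"
        by (induction rule: reach_induct) (use \<open>h \<in> H\<close> h closed in blast)+
      then show False using x by blast
    qed
    then have HD: "H \<inter> D = {v}" using D(1) vD vH by blast
    have "P (H \<union> D)"
      using disjoint_levels_glue[OF ab D' HD] HV \<open>D \<subseteq> V\<close> unfolding P_def by blast
    then have "H \<union> D = H" using max' by blast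
    then show False using HD D(2) by blast
  qed
  then show ?thesis using ab by blast
qed

section \<open>Bipartite blocks\<close>

text \<open>Each step down changes sides, so the parity of a level only records whether
  \<open>x\<close> is on the side of \<open>v\<close>.\<close>

lemma bipartite_levels_parity:
  assumes "bipartite W F" "levels W F v a" "levels W F v b" "x \<in> W"
  shows "even (a x) = even (b x)"
proof -
  obtain X Y where XY: "X \<inter> Y = {}" "X \<union> Y = W"
    and e: "\<And>x y. F x y \<Longrightarrow> x \<in> W \<Longrightarrow> y \<in> W \<Longrightarrow> (x \<in> X \<and> y \<in> Y) \<or> (x \<in> Y \<and> y \<in> X)"
    using assms(1) unfolding bipartite_def by blast
  have "even (a x) \<longleftrightarrow> (x \<in> X \<longleftrightarrow> v \<in> X)" if a: "levels W F v a" "x \<in> W" for a x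
    using a(2)
  proof (induction "a x" arbitrary: x)
    case 0
    then show ?case using levels_eq_0[OF a(1)] by (metis even_zero)
  next
    case (Suc n)
    then obtain y where y: "y \<in> W" "F y x" "a x = Suc (a y)"
      using a(1) unfolding levels_def by (metis Diff_iff nat.distinct(1) singletonD)
    then have "even (a y) \<longleftrightarrow> (y \<in> X \<longleftrightarrow> v \<in> X)" using Suc by simp
    moreover have "(y \<in> X) \<noteq> (x \<in> X)" using e[OF y(2,1) Suc.prems] XY(1) by blast
    ultimately show ?case using y(3) by auto
  qed
  then show ?thesis using assms(2-4) by blast
qed

text \<open>A walk from \<open>cs ! 0\<close> that avoids indices \<open>p\<close> and
  \<open>q\<close> never enters the range between them, where the antipode lies.\<close>

lemma separates_if_indices:
  assumes "distinct cs" "length cs = 2 * k" "0 < p" "p < k" "k < q" "q < 2 * k"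
    "hd ps = cs ! p" "last ps = cs ! q"
  shows "separates ps cs (cs ! 0) (antipode cs)"
proof -
  define R where "R = set cs - {hd ps, last ps}"
  have mem: "cs ! l \<in> R" if "l < 2 * k" "l \<noteq> p" "l \<noteq> q" for l
    using that assms by (auto simp: R_def nth_eq_iff_index_eq)
  have "\<exists>i<2 * k. y = cs ! i \<and> (i < p \<or> q < i)" if "reach R (cycle_adj cs) (cs ! 0) y" for y
    using that
  proof (induction rule: reach_induct)
    case base
    show ?case using assms by (intro exI[of _ 0]) auto
  next
    case (step y z)
    then obtain i where i: "i < 2 * k" "y = cs ! i" "i < p \<or> q < i" by blast
    obtain j where j: "j < 2 * k" "z = cs ! j" "j = (i + 1) mod (2 * k) \<or> i = (j + 1) mod (2 * k)"
    proof -
      obtain l where l: "l < length cs" "(y = cs ! l \<and> z = cs ! ((l + 1) mod length cs)) \<or>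
          (z = cs ! l \<and> y = cs ! ((l + 1) mod length cs))"
        using \<open>cycle_adj cs y z\<close> unfolding cycle_adj_def by blast
      have k: "(l + 1) mod (2 * k) < 2 * k" using assms by simp
      show thesis
      proof (cases "y = cs ! l \<and> z = cs ! ((l + 1) mod length cs)")
        case True
        then have "l = i" using i l assms(1,2) by (simp add: nth_eq_iff_index_eq)
        then show thesis using that[of "(l + 1) mod (2 * k)"] True k assms(2) by simp
      next
        case False
        then have z: "z = cs ! l" "y = cs ! ((l + 1) mod (2 * k))" using l assms(2) by auto
        then have "i = (l + 1) mod (2 * k)" using i k assms(1,2) by (simp add: nth_eq_iff_index_eq)
        then show thesis using that[of l] z l assms(2) by simp
      qed
    qed
    have "j \<noteq> p" "j \<noteq> q" using \<open>z \<in> R\<close> j(2) assms(7,8) by (auto simp: R_def)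
    moreover have "j = Suc i \<or> i = Suc j \<or> i = 0 \<or> j = 0"
      using j(1,3) i(1) by (auto simp: mod_Suc split: if_splits)
    moreover have "i = 0 \<Longrightarrow> j = Suc 0 \<or> j = 2 * k - 1"
      using j(1,3) assms(3,4) by (auto simp: mod_Suc split: if_splits)
    ultimately show ?case
      using i(3) j(1,2) assms(3-6) by (intro exI[of _ j]) auto
  qed
  then have "\<not> reach R (cycle_adj cs) (cs ! 0) (cs ! k)"
    using assms by (fastforce simp: nth_eq_iff_index_eq)
  then show ?thesis
    using mem[of 0] mem[of k] assms(2-6) unfolding separates_def antipode_def R_def by (simp add: Let_def)
qed

text \<open>\<open>L\<close> and \<open>R\<close> are the open arcs between \<open>cs ! 0\<close>
  and \<open>cs ! k\<close>. A connecting path is stopped at its first vertex on \<open>R\<close>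
  and started at its last vertex on \<open>L\<close>; as both division points are avoided, its
  interior misses the cycle.\<close>

lemma chordal_path_exists:
  assumes "symp F" "is_cycle W F cs" "length cs = 2 * k" "0 < i" "i < k" "k < j" "j < 2 * k"
    "reach (W - {cs ! 0, cs ! k}) F (cs ! i) (cs ! j)"
  shows "\<exists>ps. is_path W F ps \<and> chordal_path ps cs \<and> separates ps cs (cs ! 0) (antipode cs)"
proof -
  define L where "L = (!) cs ` {0<..<k}"
  define R where "R = (!) cs ` {k<..<2*k}"
  have cs: "distinct cs" using assms(2) by (simp add: is_cycle_def)
  have LR: "L \<inter> R = {}"
    using cs assms(3) by (auto simp: L_def R_def nth_eq_iff_index_eq)
  have "x \<in> insert (cs ! 0) (insert (cs ! k) (L \<union> R))" if x: "x \<in> set cs" for x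
  proof -
    obtain l where "l < 2 * k" "x = cs ! l" using x assms(3) by (metis in_set_conv_nth)
    moreover have "l = 0 \<or> l = k \<or> l \<in> {0<..<k} \<or> l \<in> {k<..<2*k}" using calculation by auto
    ultimately show ?thesis by (auto simp: L_def R_def)
  qed
  moreover have "L \<union> R \<subseteq> set cs" using assms(3) by (auto simp: L_def R_def)
  ultimately have split: "set cs - {cs ! 0, cs ! k} \<subseteq> L \<union> R" "L \<union> R \<subseteq> set cs" by auto
  have "cs ! i \<in> L" "cs ! j \<in> R" using assms by (auto simp: L_def R_def)
  obtain xs where xs: "xs \<noteq> []" "hd xs = cs ! i" "last xs \<in> R" "set (butlast xs) \<inter> R = {}"
    "distinct xs" "set xs \<subseteq> W - {cs ! 0, cs ! k}" "successively F xs"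
    using reach_first_hit[OF assms(8) \<open>cs ! j \<in> R\<close>] .
  have "\<exists>x\<in>set xs. x \<in> L" using xs(1,2) \<open>cs ! i \<in> L\<close> hd_in_set by metis
  then obtain us x ps where ps: "xs = us @ x # ps" "x \<in> L" "\<forall>z\<in>set ps. z \<notin> L"
    using split_list_last_prop[of xs "\<lambda>x. x \<in> L"] by blast
  have "ps \<noteq> []" using xs(3) ps LR by (cases "ps = []") auto
  have "is_path W F (x # ps)"
    using xs ps by (auto simp: is_path_iff_successively successively_append_iff)
  moreover have "chordal_path (x # ps) cs"
  proof -
    have "z = last ps" if z: "z \<in> set ps" "z \<in> set cs" for z
    proof (rule ccontr)
      assume "z \<noteq> last ps"
      then have "z \<in> set (butlast ps)"
        using z(1) \<open>ps \<noteq> []\<close> by (metis append_butlast_last_id in_set_conv_decomp rotate1.simps(2) set_ConsD set_rotate1)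
      then have "z \<in> set (butlast xs)" using ps(1) \<open>ps \<noteq> []\<close> by (simp add: butlast_append)
      then have "z \<notin> R" using xs(4) by blast
      moreover have "z \<notin> L" using ps(3) z(1) by blast
      moreover have "z \<in> set cs - {cs ! 0, cs ! k}" using z xs(6) ps(1) by auto
      ultimately show False using split by blast
    qed
    moreover have "last ps \<in> set cs" using xs(3) ps(1) \<open>ps \<noteq> []\<close> split(2) by auto
    moreover have "x \<in> set cs" using ps(2) split(2) by blast
    ultimately show ?thesis
      using \<open>ps \<noteq> []\<close> by (auto simp: chordal_path_def)
  qed
  moreover obtain p where "p \<in> {0<..<k}" "x = cs ! p" using ps(2) by (auto simp: L_def)
  moreover obtain q where "q \<in> {k<..<2*k}" "last xs = cs ! q" using xs(3) by (auto simp: R_def)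
  ultimately show ?thesis
    using separates_if_indices[OF cs assms(3), of p q "x # ps"] ps(1) \<open>ps \<noteq> []\<close> by auto
qed

section \<open>Branches to the root and the theta graph they yield\<close>

text \<open>Fixing one parent per vertex turns the branch from \<open>x\<close> to \<open>v\<close>
  into the iterates \<open>(p ^^ i) x\<close>, with level \<open>a x - i\<close>.\<close>

definition parents :: "'a set \<Rightarrow> ('a \<Rightarrow> 'a \<Rightarrow> bool) \<Rightarrow> 'a \<Rightarrow> ('a \<Rightarrow> nat) \<Rightarrow> ('a \<Rightarrow> 'a) \<Rightarrow> bool" where
  "parents W F v a p \<longleftrightarrow>
     levels W F v a \<and> (\<forall>x\<in>W - {v}. p x \<in> W \<and> F (p x) x \<and> a x = Suc (a (p x)))"

lemma parents_exist: "levels W F v a \<Longrightarrow> \<exists>p. parents W F v a p"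
  unfolding parents_def levels_def by metis

lemma parents_step:
  assumes "parents W F v a p" "x \<in> W" "x \<noteq> v"
  shows "p x \<in> W" "F (p x) x" "a x = Suc (a (p x))"
  using assms by (auto simp: parents_def)

lemma parents_iterate:
  assumes "parents W F v a p" "x \<in> W" "i \<le> a x"
  shows "(p ^^ i) x \<in> W \<and> a ((p ^^ i) x) = a x - i"
  using assms(3)
proof (induction i)
  case (Suc i)
  then have i: "(p ^^ i) x \<in> W" "a ((p ^^ i) x) = a x - i" by auto
  then have "(p ^^ i) x \<noteq> v" using Suc.prems assms(1) by (auto simp: parents_def levels_def)
  then show ?case using parents_step[OF assms(1) i(1)] i(2) by simp
qed (use assms in simp)

lemma parents_iterate_not_root:
  assumes "parents W F v a p" "x \<in> W" "i < a x"
  shows "(p ^^ i) x \<in> W - {v}"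
proof -
  have "(p ^^ i) x \<in> W" "a ((p ^^ i) x) = a x - i"
    using parents_iterate[OF assms(1,2), of i] assms(3) by auto
  moreover have "a v = 0" using assms(1) by (simp add: parents_def levels_def)
  ultimately show ?thesis using assms(3) by auto
qed

lemma parents_iterate_edge:
  assumes "parents W F v a p" "x \<in> W" "i < a x"
  shows "F ((p ^^ Suc i) x) ((p ^^ i) x)"
  using parents_step(2)[OF assms(1), of "(p ^^ i) x"] parents_iterate_not_root[OF assms] by simp

lemma parents_iterate_root:
  assumes "parents W F v a p" "x \<in> W"
  shows "(p ^^ a x) x = v"
  using parents_iterate[OF assms, of "a x"] levels_eq_0 assms(1) unfolding parents_def by fastforce

lemma parents_iterate_inj:
  assumes "parents W F v a p" "x \<in> W" "i \<le> a x" "j \<le> a x" "(p ^^ i) x = (p ^^ j) x"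
  shows "i = j"
proof -
  have "a x - i = a x - j"
    using parents_iterate[OF assms(1,2)] assms(3-5) by metis
  then show ?thesis using assms(3,4) by simp
qed

lemma parents_iterate_reach:
  assumes "symp F" "parents W F v a p" "x \<in> W" "i \<le> j" "j < a x"
    "\<And>l. i \<le> l \<Longrightarrow> l \<le> j \<Longrightarrow> (p ^^ l) x \<in> S"
  shows "reach S F ((p ^^ i) x) ((p ^^ j) x)"
  using assms(4-6)
proof (induction j rule: dec_induct)
  case base
  then show ?case by (simp add: reach_refl)
next
  case (step j)
  have "F ((p ^^ j) x) ((p ^^ Suc j) x)"
    using parents_iterate_edge[OF assms(2,3), of j] step.prems assms(1) by (simp add: symp_def)
  moreover have "(p ^^ j) x \<in> S" "(p ^^ Suc j) x \<in> S"
    using step.hyps step.prems(2)[of j] step.prems(2)[of "Suc j"] by auto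
  ultimately have "reach S F ((p ^^ j) x) ((p ^^ Suc j) x)" by (rule reach_edge)
  moreover have "reach S F ((p ^^ i) x) ((p ^^ j) x)" using step by auto
  ultimately show ?case using reach_trans by metis
qed

text \<open>The list starts at \<open>v\<close>, follows the \<open>q\<close>-branch up to
  \<open>g\<close> at index \<open>b g\<close> and returns along the \<open>p\<close>-branch. The
  bound \<open>len\<close> excludes \<open>g = v\<close> and two branches that are the same single
  edge.\<close>

lemma cycle_of_branches:
  assumes "symp F" and a: "parents W F v a p" and b: "parents W F v b q" and g: "g \<in> W"
    and dis: "\<And>i j. 1 \<le> i \<Longrightarrow> i < a g \<Longrightarrow> 1 \<le> j \<Longrightarrow> j < b g \<Longrightarrow> (p ^^ i) g \<noteq> (q ^^ j) g"
    and len: "3 \<le> a g + b g"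
  defines "cs \<equiv> map (\<lambda>i. if i \<le> b g then (q ^^ (b g - i)) g else (p ^^ (i - b g)) g) [0..<a g + b g]"
  shows "is_cycle W F cs"
proof -
  let ?c = "\<lambda>i. if i \<le> b g then (q ^^ (b g - i)) g else (p ^^ (i - b g)) g"
  let ?n = "a g + b g"
  have sym: "F x y \<Longrightarrow> F y x" for x y using assms(1) by (simp add: symp_def)
  have v: "a v = 0" "b v = 0" using a b by (auto simp: parents_def levels_def)
  have roots: "(p ^^ a g) g = v" "(q ^^ b g) g = v"
    using parents_iterate_root[OF a g] parents_iterate_root[OF b g] by auto
  have mixed: "?c i \<noteq> ?c j" if ij: "i \<le> b g" "b g < j" "j < ?n" for i j
  proof -
    have j: "j - b g < a g" "0 < j - b g" using ij by auto
    consider "i = 0" | "i = b g" | "1 \<le> b g - i" "b g - i < b g" using ij(1) by linarith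
    then have "(p ^^ (j - b g)) g \<noteq> (q ^^ (b g - i)) g"
    proof cases
      case 1
      then show ?thesis using parents_iterate_not_root[OF a g j(1)] roots by auto
    next
      case 2
      then show ?thesis using parents_iterate_inj[OF a g, of "j - b g" 0] j by auto
    next
      case 3
      then show ?thesis using dis[of "j - b g" "b g - i"] j by auto
    qed
    then show ?thesis using ij by auto
  qed
  have inj: "inj_on ?c {0..<?n}"
  proof (rule linorder_inj_onI)
    fix i j assume ij: "i < j" "i \<in> {0..<?n}" "j \<in> {0..<?n}"
    consider "j \<le> b g" | "b g < i" | "i \<le> b g" "b g < j" by linarith
    then show "?c i \<noteq> ?c j"
    proof cases
      case 1
      then show ?thesis using ij parents_iterate_inj[OF b g, of "b g - i" "b g - j"] by auto
    next
      case 2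
      then have "i - b g \<le> a g" "j - b g \<le> a g" "i - b g \<noteq> j - b g" using ij by auto
      then show ?thesis using 2 ij parents_iterate_inj[OF a g] by auto
    next
      case 3
      then show ?thesis using mixed ij by auto
    qed
  qed auto
  have mem: "?c i \<in> W" if "i < ?n" for i
    using that parents_iterate[OF a g, of "i - b g"] parents_iterate[OF b g, of "b g - i"] by auto
  have edge: "F (?c i) (?c (Suc i mod ?n))" if i: "i < ?n" for i
  proof -
    \<comment> \<open>Both branches end in \<open>v\<close>, so the formula for the
      \<open>p\<close>-branch at index \<open>a g + b g\<close> agrees with index 0.\<close>
    have next': "?c (Suc i mod ?n) = (if Suc i \<le> b g then (q ^^ (b g - Suc i)) g else (p ^^ (Suc i - b g)) g)"
    proof (cases "Suc i = ?n")
      case True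
      then show ?thesis using roots by (cases "a g") auto
    next
      case False
      then show ?thesis using i by simp
    qed
    show ?thesis
    proof (cases "i < b g")
      case True
      then show ?thesis
        unfolding next' using parents_iterate_edge[OF b g, of "b g - Suc i"] by (simp add: Suc_diff_Suc)
    next
      case False
      have "F ((p ^^ (i - b g)) g) ((p ^^ Suc (i - b g)) g)"
        using parents_iterate_edge[OF a g, of "i - b g"] False i sym by simp
      moreover have "?c i = (p ^^ (i - b g)) g" using False by auto
      ultimately show ?thesis unfolding next' using False by (simp add: Suc_diff_le)
    qed
  qed
  have cs: "length cs = ?n" "\<And>i. i < ?n \<Longrightarrow> cs ! i = ?c i" by (simp_all add: cs_def)
  have "distinct cs" unfolding cs_def distinct_map using inj by simp
  moreover have "set cs \<subseteq> W" using mem cs by (metis in_set_conv_nth subsetI)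
  moreover have "F (cs ! i) (cs ! ((i + 1) mod length cs))" if "i < length cs" for i
  proof -
    have "i < ?n" "Suc i mod ?n < ?n" using that cs(1) len mod_less_divisor[of ?n "Suc i"] by linarith+
    then show ?thesis using edge[of i] cs(2)[of i] cs(2)[of "Suc i mod ?n"] by (simp only: cs(1) Suc_eq_plus1)
  qed
  ultimately show ?thesis using len by (simp add: is_cycle_def cs(1))
qed

text \<open>Here \<^term>\<open>K z\<close> is the component of \<^term>\<open>W - {v, z}\<close> that \<^term>\<open>z\<close> points into, and
  \<^term>\<open>X\<close> is a sink of this pointing. The branch of \<^term>\<open>b\<close> at \<^term>\<open>g\<close> stays in \<^term>\<open>X\<close> beyond
  the antipode of the cycle formed by the two branches at \<^term>\<open>g\<close>, so deleting \<^term>\<open>v\<close> and the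
  antipode does not separate the two arcs of the cycle.\<close>

lemma theta_from_gate:
  fixes a b :: "'a \<Rightarrow> nat" and D :: "'a \<Rightarrow> 'a" and Y :: "'a set"
  assumes F: "symp F" and a: "parents W F v a p" and b: "parents W F v b q"
    and ne: "\<And>x. x \<in> W - {v} \<Longrightarrow> a x \<noteq> b x" and par: "\<And>x. x \<in> W \<Longrightarrow> even (a x) = even (b x)"
    and D: "\<And>z. z \<in> W - {v} \<Longrightarrow> D z = (if b z < a z then p z else q z)"
    and K_def: "\<And>z. K z = {y. reach (W - {v} - {z}) F (D z) y}"
    and X_def: "X = {x \<in> W - {v}. \<forall>z\<in>Y. x \<in> insert z (K z)}"
    and Y: "Y \<subseteq> W - {v}" "X \<subseteq> Y" and closed: "\<And>x. x \<in> X \<Longrightarrow> D x \<in> X"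
    and g: "g \<in> X" "p g \<notin> X" and max: "\<And>x. x \<in> X \<Longrightarrow> q x \<notin> X \<Longrightarrow> b x \<le> a g"
  shows "\<exists>cs ps. is_cycle W F cs \<and> even (length cs) \<and> cs ! 0 = v \<and>
                 is_path W F ps \<and> chordal_path ps cs \<and> separates ps cs v (antipode cs)"
proof -
  have gW: "g \<in> W" "g \<noteq> v" using g(1) by (auto simp: X_def)
  have XK: "x \<in> K z" if "x \<in> X" "z \<in> Y" "x \<noteq> z" for x z
    using that by (auto simp: X_def)
  have sym: "F x y \<Longrightarrow> F y x" for x y using F by (simp add: symp_def)
  \<comment> \<open>\<open>D g\<close> lies in \<open>X\<close> while \<open>p g\<close> does not,
    so \<open>g\<close> points along \<open>q\<close>; equal parity raises the gap between its
    levels to 2.\<close>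
  have "\<not> b g < a g" using g closed[OF g(1)] D[of g] gW by auto
  then have Dg: "D g = q g" and "a g < b g" using D[of g] ne[of g] gW by auto
  then have ab: "a g + 2 \<le> b g" using par[OF gW(1)] by presburger
  have apos: "0 < a g" using a gW levels_pos unfolding parents_def by metis
  \<comment> \<open>If the \<open>p\<close>-branch met \<open>K g\<close>, then \<open>p g\<close>
    would be in \<open>K g\<close>. Since \<open>p g\<close> is not in \<open>X\<close>, some other
    \<open>z\<close> in \<open>Y\<close> has \<open>p g\<close> outside \<open>K z\<close>; but
    \<open>g\<close> lies in \<open>K z\<close> and is adjacent to \<open>p g\<close>.\<close>
  have aK: "(p ^^ i) g \<notin> K g" if i: "1 \<le> i" "i < a g" for i
  proof
    assume "(p ^^ i) g \<in> K g"
    have off: "(p ^^ l) g \<in> W - {v} - {g}" if "1 \<le> l" "l \<le> i" for l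
      using parents_iterate_not_root[OF a gW(1), of l] parents_iterate_inj[OF a gW(1), of l 0] that i by auto
    have "reach (W - {v} - {g}) F ((p ^^ 1) g) ((p ^^ i) g)"
      using i off by (intro parents_iterate_reach[OF F a gW(1)]) auto
    then have pK: "p g \<in> K g"
      using \<open>(p ^^ i) g \<in> K g\<close> reach_trans reach_sym[OF F] unfolding K_def by fastforce
    have pW: "p g \<in> W - {v}" using off[of 1] i by auto
    then obtain z where z: "z \<in> Y" "p g \<noteq> z" "p g \<notin> K z" using g(2) unfolding X_def by blast
    then have "z \<noteq> g" using pK by blast
    then have "g \<in> K z" using XK[OF g(1) z(1)] by simp
    then have "reach (W - {v} - {z}) F (D z) g" by (simp add: K_def)
    moreover have "reach (W - {v} - {z}) F g (p g)"
    proof (rule reach_edge)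
      show "F g (p g)" using parents_step(2)[OF a gW] sym by blast
    qed (use pW z(2) gW \<open>z \<noteq> g\<close> in auto)
    ultimately have "p g \<in> K z" unfolding K_def using reach_trans by fast
    then show False using z(3) by simp
  qed
  \<comment> \<open>The \<open>q\<close>-branch starts at \<open>D g\<close> and avoids
    \<open>g\<close> and \<open>v\<close> in between. With \<open>aK\<close>, the two branches meet
    only at their ends.\<close>
  have bK: "(q ^^ j) g \<in> K g" if j: "1 \<le> j" "j < b g" for j
  proof -
    have off: "(q ^^ l) g \<in> W - {v} - {g}" if "1 \<le> l" "l \<le> j" for l
      using parents_iterate_not_root[OF b gW(1), of l] parents_iterate_inj[OF b gW(1), of l 0] that j by auto
    have "reach (W - {v} - {g}) F ((q ^^ 1) g) ((q ^^ j) g)"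
      using j off by (intro parents_iterate_reach[OF F b gW(1)]) auto
    then show ?thesis by (simp add: K_def Dg)
  qed
  define cs where "cs = map (\<lambda>i. if i \<le> b g then (q ^^ (b g - i)) g else (p ^^ (i - b g)) g) [0..<a g + b g]"
  have cyc: "is_cycle W F cs"
    unfolding cs_def
  proof (rule cycle_of_branches[OF F a b gW(1)])
    show "(p ^^ i) g \<noteq> (q ^^ j) g" if "1 \<le> i" "i < a g" "1 \<le> j" "j < b g" for i j
      using aK bK that by metis
  qed (use ab apos in linarith)
  obtain h where h: "a g + b g = 2 * h" using par[OF gW(1)] by (metis even_add evenE)
  then have h': "a g < h" "h < b g" using ab by linarith+
  have len: "length cs = 2 * h" by (simp add: cs_def h)
  have nth: "cs ! i = (q ^^ (b g - i)) g" if "i \<le> b g" for i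
    using that apos by (simp add: cs_def)
  have cs0: "cs ! 0 = v" using nth[of 0] parents_iterate_root[OF b gW(1)] by simp
  have csb: "cs ! b g = g" using nth[of "b g"] by simp
  \<comment> \<open>\<open>j\<close> counts the steps until the \<open>q\<close>-branch first leaves
    \<open>X\<close>; the last vertex before that has cycle index and \<open>b\<close>-level
    \<open>i\<close>. By \<open>max\<close>, \<open>i \<le> a g < h < b g\<close>, so the antipode
    at index \<open>h\<close> is on the part of the branch inside \<open>X\<close>.\<close>
  define j where "j = (LEAST j. (q ^^ j) g \<notin> X)"
  have "(q ^^ b g) g \<notin> X" using parents_iterate_root[OF b gW(1)] by (simp add: X_def)
  then have j: "(q ^^ j) g \<notin> X" "j \<le> b g"
    unfolding j_def by (rule LeastI[of "\<lambda>j. (q ^^ j) g \<notin> X"], rule Least_le)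
  have inX: "(q ^^ l) g \<in> X" if "l < j" for l
    using that not_less_Least unfolding j_def by blast
  have jpos: "0 < j" using j(1) g(1) by (cases j) auto
  define i where "i = b g - (j - 1)"
  have i: "0 < i" "b g - i = j - 1" "i \<le> b g" using jpos j(2) by (auto simp: i_def)
  have "(q ^^ (j - 1)) g \<in> X" using inX jpos by simp
  moreover have "q ((q ^^ (j - 1)) g) \<notin> X"
    using j(1) jpos by (metis Suc_diff_1 comp_apply funpow.simps(2))
  ultimately have "b ((q ^^ (j - 1)) g) \<le> a g" by (rule max)
  then have ia: "i \<le> a g" using parents_iterate[OF b gW(1), of "j - 1"] j(2) by (simp add: i_def)
  have "b g - h < j" using ia h' i(2,3) by linarith
  then have "cs ! h \<in> X" using inX nth[of h] h' by simp
  then have mY: "cs ! h \<in> Y" using Y(2) by blast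
  have dis: "distinct cs" using cyc by (simp add: is_cycle_def)
  \<comment> \<open>\<open>cs ! i\<close> and \<open>g\<close> are on different arcs, and both lie
    in \<open>X\<close>; so the component into which the antipode points contains both.\<close>
  have "cs ! i \<in> X" using inX[of "j - 1"] nth[of i] i jpos by simp
  moreover have "b g < length cs" using len h apos by linarith
  then have "cs ! i \<noteq> cs ! h" "g \<noteq> cs ! h"
    using nth_eq_iff_index_eq[OF dis, of i h] nth_eq_iff_index_eq[OF dis, of "b g" h] len ia h' csb
    by auto
  ultimately have "cs ! i \<in> K (cs ! h)" "g \<in> K (cs ! h)"
    using XK[OF _ mY] g(1) by blast+
  then have "reach (W - {v} - {cs ! h}) F (D (cs ! h)) (cs ! i)"
    "reach (W - {v} - {cs ! h}) F (D (cs ! h)) g"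
    by (simp_all add: K_def)
  then have "reach (W - {v} - {cs ! h}) F (cs ! i) g"
    by (rule reach_trans[OF reach_sym[OF F]])
  moreover have "W - {v} - {cs ! h} = W - {cs ! 0, cs ! h}" using cs0 by blast
  ultimately have r: "reach (W - {cs ! 0, cs ! h}) F (cs ! i) (cs ! b g)" using csb by simp
  have "\<exists>ps. is_path W F ps \<and> chordal_path ps cs \<and> separates ps cs (cs ! 0) (antipode cs)"
    by (rule chordal_path_exists[OF F cyc len i(1) _ h'(2) _ r]) (use ia h h' apos in linarith)+
  then show ?thesis using cyc len cs0 by auto
qed

text \<open>Supplies the data of \<open>theta_from_gate\<close>. The set \<open>X\<close> is
  nonempty and closed under \<open>D\<close>, but parents must leave it because levels fall;
  \<open>g\<close> is an exit of highest level among those of both level functions.\<close>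

lemma theta_exists:
  fixes a b :: "'a \<Rightarrow> nat"
  assumes F: "symp F" and fin: "finite W" and "W \<noteq> {v}"
    and ab: "disjoint_levels W F v a b" and par: "\<And>x. x \<in> W \<Longrightarrow> even (a x) = even (b x)"
  shows "\<exists>cs ps. is_cycle W F cs \<and> even (length cs) \<and> cs ! 0 = v \<and>
                 is_path W F ps \<and> chordal_path ps cs \<and> separates ps cs v (antipode cs)"
proof -
  have la: "levels W F v a" and lb: "levels W F v b" and ne: "\<And>x. x \<in> W - {v} \<Longrightarrow> a x \<noteq> b x"
    using ab by (auto simp: disjoint_levels_def)
  obtain p q where p: "parents W F v a p" and q: "parents W F v b q"
    using parents_exist[OF la] parents_exist[OF lb] by blast
  have sym: "F x y \<Longrightarrow> F y x" for x y using F by (simp add: symp_def)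
  have a0: "a v = 0" "b v = 0" and vW: "v \<in> W" using la lb by (auto simp: levels_def)
  let ?H = "W - {v}"
  define D where "D z = (if b z < a z then p z else q z)" for z
  define K where "K z = {y. reach (?H - {z}) F (D z) y}" for z
  \<comment> \<open>The two levels are positive and differ, so the larger is at least 2 and its
    parent is not \<open>v\<close>.\<close>
  have DH: "D z \<in> ?H - {z} \<and> F z (D z)" if z: "z \<in> ?H" for z
  proof -
    have zz: "z \<in> W" "z \<noteq> v" using z by auto
    note ps = parents_step[OF p zz] parents_step[OF q zz]
    have pos: "0 < a z" "0 < b z" using levels_pos la lb zz by metis+
    show ?thesis
    proof (cases "b z < a z")
      case True
      then have "a (p z) \<noteq> 0" "a (p z) \<noteq> a z" using ps(3) pos by linarith+
      then have "p z \<noteq> v" "p z \<noteq> z" using a0 by auto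
      then show ?thesis using True ps sym by (simp add: D_def)
    next
      case False
      then have "b (q z) \<noteq> 0" "b (q z) \<noteq> b z" using ps(6) pos ne[OF z] by linarith+
      then have "q z \<noteq> v" "q z \<noteq> z" using a0 by auto
      then show ?thesis using False ps sym by (simp add: D_def)
    qed
  qed
  have DK: "D z \<in> K z" if "z \<in> ?H" for z
    using DH[OF that] by (simp add: K_def reach_refl)
  have KH: "K z \<subseteq> ?H - {z}" for z
  proof
    fix y assume "y \<in> K z"
    then have "reach (?H - {z}) F (D z) y" by (simp add: K_def)
    then show "y \<in> ?H - {z}" by (rule reach_mem[THEN conjunct2])
  qed
  have K_step: "w \<in> K z" if "y \<in> K z" "F y w" "w \<in> ?H" "w \<noteq> z" for y w z
  proof -
    have "reach (?H - {z}) F (D z) y" using that(1) by (simp add: K_def)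
    moreover have "reach (?H - {z}) F y w"
      using that KH[of z] by (intro reach_edge) auto
    ultimately show ?thesis unfolding K_def by (simp add: reach_trans[of _ _ "D z" y w])
  qed
  have finK: "finite (K z)" for z using KH fin by (meson finite_Diff finite_subset)
  have "?H \<noteq> {}" using assms(3) vW by blast
  then obtain z0 where z0: "z0 \<in> ?H" and min: "\<And>z. z \<in> ?H \<Longrightarrow> card (K z0) \<le> card (K z)"
    using ex_has_least_nat[of "\<lambda>z. z \<in> ?H" _ "\<lambda>z. card (K z)"] by (metis all_not_in_conv)
  define Y where "Y = insert z0 (K z0)"
  define X where "X = {x \<in> ?H. \<forall>z\<in>Y. x \<in> insert z (K z)}"
  have YH: "Y \<subseteq> ?H" using KH[of z0] z0 by (auto simp: Y_def)
  have XY: "X \<subseteq> Y" by (auto simp: X_def Y_def)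
  \<comment> \<open>Otherwise \<open>K z\<close>, which contains the neighbour \<open>D z\<close> of
    \<open>z\<close>, could not get out of \<open>K z0\<close> without passing \<open>z0\<close>.
    Missing \<open>z\<close>, it would be a proper subset, against the choice of
    \<open>z0\<close>.\<close>
  have "z0 \<in> K z" if z: "z \<in> K z0" for z
  proof (rule ccontr)
    assume no: "z0 \<notin> K z"
    have zH: "z \<in> ?H" "z \<noteq> z0" using z KH[of z0] by auto
    have "y \<in> K z0" if "y \<in> K z" for y
    proof -
      have enter: "y \<in> K z0" if "x \<in> K z0" "F x y" "y \<in> K z" for x y
        using K_step[OF that(1,2)] that(3) no KH[of z] by blast
      have "reach (?H - {z}) F (D z) y" using that by (simp add: K_def)
      then have "y \<in> K z \<and> y \<in> K z0"
      proof (induction rule: reach_induct)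
        case base
        then show ?case using enter[OF z] DH[OF zH(1)] DK[OF zH(1)] by blast
      next
        case (step y w)
        then have "w \<in> K z" using K_step[of y z w] by blast
        then show ?case using enter[of y w] step by blast
      qed
      then show ?thesis by blast
    qed
    then have "K z \<subset> K z0" using z KH[of z] by blast
    then have "card (K z) < card (K z0)" using finK by (simp add: psubset_card_mono)
    then show False using min[OF zH(1)] by simp
  qed
  then have z0X: "z0 \<in> X" using z0 by (auto simp: X_def Y_def)
  \<comment> \<open>For \<open>z\<close> other than \<open>x\<close> and \<open>D x\<close>, the
    component \<open>K z\<close> contains \<open>x\<close> and hence its neighbour
    \<open>D x\<close>.\<close>
  have closed: "D x \<in> X" if x: "x \<in> X" for x
  proof -
    have xH: "x \<in> ?H" using x by (simp add: X_def)
    have "D x \<in> insert z (K z)" if z: "z \<in> Y" for z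
    proof (cases "z = x \<or> z = D x")
      case True
      then show ?thesis using DK[OF xH] by auto
    next
      case False
      then have "x \<in> K z" using x z by (auto simp: X_def)
      then show ?thesis using K_step[of x z "D x"] DH[OF xH] False by blast
    qed
    then show ?thesis using DH[OF xH] by (simp add: X_def)
  qed
  have finX: "finite X" using fin by (simp add: X_def)
  obtain x0 where x0: "x0 \<in> X" and x0_min: "\<And>x. x \<in> X \<Longrightarrow> a x0 \<le> a x"
    using ex_has_least_nat[of "\<lambda>x. x \<in> X" z0 a] z0X by blast
  \<comment> \<open>The parent has a smaller \<open>a\<close>-level than the least one in
    \<open>X\<close>, so at least one exit exists.\<close>
  have "p x0 \<notin> X"
    using x0_min[of "p x0"] parents_step(3)[OF p, of x0] x0 by (auto simp: X_def)
  define G where "G = a ` {x \<in> X. p x \<notin> X} \<union> b ` {x \<in> X. q x \<notin> X}"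
  have "finite G" "G \<noteq> {}" using finX x0 \<open>p x0 \<notin> X\<close> by (auto simp: G_def)
  then obtain n where n: "n \<in> G" and n_max: "\<And>k. k \<in> G \<Longrightarrow> k \<le> n" using Max_in Max_ge by metis
  from n consider g where "g \<in> X" "p g \<notin> X" "n = a g" | g where "g \<in> X" "q g \<notin> X" "n = b g"
    unfolding G_def by blast
  then show ?thesis
  proof cases
    case 1
    show ?thesis
    proof (rule theta_from_gate[OF F p q ne par D_def K_def X_def YH XY closed 1(1,2)])
      show "b x \<le> a g" if "x \<in> X" "q x \<notin> X" for x
        using n_max[of "b x"] that 1(3) by (auto simp: G_def)
    qed
  next
    case 2
    \<comment> \<open>proof (rule theta_from_gate[OF F q p Exchanging \<open>a\<close> and
      \<open>b\<close> leaves \<open>D\<close> unchanged, as the two levels never tie off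
      \<open>v\<close>.\<close>
    show ?thesis
    proof (rule theta_from_gate[OF F q p ne[symmetric] par[symmetric] _ K_def X_def YH XY closed 2(1,2)])
      show "a x \<le> b g" if "x \<in> X" "p x \<notin> X" for x
        using n_max[of "a x"] that 2(3) by (auto simp: G_def)
      show "D z = (if a z < b z then q z else p z)" if "z \<in> ?H" for z
        using ne[OF that] by (auto simp: D_def)
    qed
  qed
qed

section \<open>Size of the blocks at the root, and the equivalence\<close>

lemma simple_graph_block:
  assumes "simple_graph V E" "is_block V E W F"
  shows "finite W" "symp F" "\<not> F x x"
  using assms block_props(1)[OF assms] unfolding block_induced[OF assms]
  by (auto simp: simple_graph_def induced_def symp_def intro: finite_subset)

lemma block_two_connected:
  assumes "simple_graph V E" "is_block V E W F" "3 \<le> card W"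
  shows "two_connected W F"
proof -
  have "connected_graph (W - {x}) F" if "x \<in> W" for x
  proof -
    have "W - {x} \<noteq> {}"
      using assms(3) that card_mono[of "{x}" W] by auto
    moreover have "reach (W - {x}) F u w" if "u \<in> W - {x}" "w \<in> W - {x}" for u w
      using block_connected_minus[OF assms(1,2) that] reach_induced[of "W - {x}" W E]
      by (simp add: block_induced[OF assms(1,2)])
    ultimately show ?thesis by (auto simp: connected_graph_def)
  qed
  moreover have "connected_graph W F" using assms(2) by (simp add: is_block_def)
  ultimately show ?thesis
    using assms(3) simple_graph_block(1)[OF assms(1,2)] by (simp add: two_connected_def)
qed

text \<open>As \<open>V \<noteq> {v}\<close>, the root has a neighbour, and the block of that edge
  properly contains \<open>{v}\<close>.\<close>

lemma block_not_singleton: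
  assumes "simple_graph V E" "connected_graph V E" "v \<in> V" "V \<noteq> {v}" "is_block V E W F"
  shows "W \<noteq> {v}"
proof
  assume W: "W = {v}"
  obtain y where y: "y \<in> V" "y \<noteq> v" using assms(3,4) by blast
  have "reach V E v y" using assms(2,3) y(1) by (rule connected_reach)
  then have "\<exists>x. E v x"
    using y(2) by (induction rule: reach_converse_induct) auto
  then obtain x where x: "E v x" by blast
  obtain W' F' where W': "is_block V E W' F'" "v \<in> W'" "x \<in> W'" using block_exists[OF assms(1) x] .
  have "W' = W"
    using W W'(2) block_props[OF assms(1) W'(1)] by (intro block_maximal[OF assms(1,5)]) auto
  then show False using W W'(3) x assms(1) by (auto simp: simple_graph_def)
qed

text \<open>Of the two different levels of a vertex \<open>x \<noteq> v\<close>, one is not 1; its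
  lower neighbour is neither \<open>v\<close> nor \<open>x\<close>.\<close>

lemma disjoint_levels_card:
  assumes "disjoint_levels W F v a b" "finite W" "W \<noteq> {v}"
  shows "3 \<le> card W"
proof -
  have la: "levels W F v a" and lb: "levels W F v b" and ne: "\<And>x. x \<in> W - {v} \<Longrightarrow> a x \<noteq> b x"
    using assms(1) by (auto simp: disjoint_levels_def)
  have v: "v \<in> W" using la by (simp add: levels_def)
  then obtain x where x: "x \<in> W" "x \<noteq> v" using assms(3) by blast
  have third: "\<exists>y\<in>W. y \<noteq> v \<and> y \<noteq> x" if l: "levels W F v l" "l x \<noteq> 1" for l
  proof -
    obtain y where "y \<in> W" "l x = Suc (l y)" using l(1) x unfolding levels_def by blast
    moreover have "l v = 0" using l(1) by (simp add: levels_def)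
    ultimately show ?thesis using l(2) by (intro bexI[of _ y]) auto
  qed
  have "a x \<noteq> 1 \<or> b x \<noteq> 1" using ne x by force
  then obtain y where "y \<in> W" "y \<noteq> v" "y \<noteq> x" using third la lb by blast
  then have "{v, x, y} \<subseteq> W" "card {v, x, y} = 3" using v x by auto
  then show ?thesis using card_mono[OF assms(2), of "{v, x, y}"] by simp
qed

theorem theorem5:
  fixes V :: "'a set" and E :: "'a \<Rightarrow> 'a \<Rightarrow> bool" and v :: 'a
  assumes "simple_graph V E" and "connected_graph V E" and "v \<in> V" and "V \<noteq> {v}"
  shows "(\<exists>S T. level_partition V E S \<and> rooted_in S v \<and> level_partition V E T \<and> rooted_in T v \<and>
                level_disjoint S T)
     \<longleftrightarrow> (\<forall>W F. is_block V E W F \<and> v \<in> W \<longrightarrow>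
            two_connected W F \<and>
            (\<not> bipartite W F \<or>
             (\<exists>cs ps. is_cycle W F cs \<and> even (length cs) \<and> cs ! 0 = v \<and>
                      is_path W F ps \<and> chordal_path ps cs \<and>
                      separates ps cs v (antipode cs))))"
proof -
  have fin: "finite V" using assms(1) by (simp add: simple_graph_def)
  have blocks: "two_connected W F \<and>
            (\<not> bipartite W F \<or>
             (\<exists>cs ps. is_cycle W F cs \<and> even (length cs) \<and> cs ! 0 = v \<and>
                      is_path W F ps \<and> chordal_path ps cs \<and>
                      separates ps cs v (antipode cs)))"
    if ab: "disjoint_levels V E v a b" and B: "is_block V E W F" "v \<in> W" for a b W F
  proof -
    note F = simple_graph_block[OF assms(1) B(1)]
    have W: "W \<noteq> {v}" using block_not_singleton[OF assms B(1)] .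
    have WF: "disjoint_levels W F v a b"
      using ab levels_block[OF assms(1) B(1) _ B(2)] block_props(1)[OF assms(1) B(1)]
      unfolding disjoint_levels_def by blast
    have "two_connected W F"
      using block_two_connected[OF assms(1) B(1) disjoint_levels_card[OF WF F(1) W]] .
    moreover have "\<exists>cs ps. is_cycle W F cs \<and> even (length cs) \<and> cs ! 0 = v \<and>
                      is_path W F ps \<and> chordal_path ps cs \<and> separates ps cs v (antipode cs)"
      if "bipartite W F"
      using theta_exists[OF F(2,1) W WF] bipartite_levels_parity[OF that] WF
      unfolding disjoint_levels_def by blast
    ultimately show ?thesis by blast
  qed
  have levels: "\<exists>D a b. D \<subseteq> W \<and> D \<noteq> {v} \<and> disjoint_levels D F v a b"
    if B: "is_block V E W F" "v \<in> W" and two: "two_connected W F"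
      and theta: "\<not> bipartite W F \<or>
             (\<exists>cs ps. is_cycle W F cs \<and> even (length cs) \<and> cs ! 0 = v \<and>
                      is_path W F ps \<and> chordal_path ps cs \<and>
                      separates ps cs v (antipode cs))" for W F
  proof (cases "bipartite W F")
    case True
    then show ?thesis
      using theta theta_disjoint_levels[OF simple_graph_block(2)[OF assms(1) B(1)]] by metis
  next
    case False
    note F = simple_graph_block[OF assms(1) B(1)]
    obtain vs where vs: "odd_cycle F (v # vs)" "set (v # vs) \<subseteq> W"
      using odd_cycle_through[OF two F(2,3) False B(2)] .
    have "vs \<noteq> []" using vs(1) F(3) by (auto simp: odd_cycle_def)
    then have "set (v # vs) \<noteq> {v}" using vs(1) by (cases vs) (auto simp: odd_cycle_def)
    then show ?thesis using vs(2) odd_cycle_disjoint_levels[OF F(2) vs(1)] by blast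
  qed
  show ?thesis
    unfolding level_disjoint_partitions_iff[OF fin] disjoint_levels_def[symmetric]
  proof (intro iffI allI impI)
    fix W F
    assume "\<exists>a b. disjoint_levels V E v a b" and B: "is_block V E W F \<and> v \<in> W"
    then obtain a b where "disjoint_levels V E v a b" by blast
    then show "two_connected W F \<and>
            (\<not> bipartite W F \<or>
             (\<exists>cs ps. is_cycle W F cs \<and> even (length cs) \<and> cs ! 0 = v \<and>
                      is_path W F ps \<and> chordal_path ps cs \<and>
                      separates ps cs v (antipode cs)))"
      using B by (intro blocks) auto
  next
    assume R: "\<forall>W F. is_block V E W F \<and> v \<in> W \<longrightarrow>
            two_connected W F \<and>
            (\<not> bipartite W F \<or>
             (\<exists>cs ps. is_cycle W F cs \<and> even (length cs) \<and> cs ! 0 = v \<and>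
                      is_path W F ps \<and> chordal_path ps cs \<and>
                      separates ps cs v (antipode cs)))"
    show "\<exists>a b. disjoint_levels V E v a b"
    proof (rule disjoint_levels_from_blocks[OF assms(1-3)])
      fix W F assume B: "is_block V E W F" "v \<in> W"
      show "\<exists>D a b. D \<subseteq> W \<and> D \<noteq> {v} \<and> disjoint_levels D F v a b"
        by (rule levels[OF B]) (use R B in blast)+
    qed
  qed
qed

end
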